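(* Let $(\mathfrak{g},\triangleright)$ be a pre-Lie algebra. Then $\big(\bigoplus_{n=0}^{+\infty}\mathfrak{C}^n_{\mathsf{PL}}(\mathfrak{g};\mathfrak{g}),\partial\big)$, with the cochain spaces and operator $\partial$ defined in the context, is a cochain complex, i.e. $\partial\circ\partial=0$.
   Context: All vector spaces are over a field of characteristic $0$. A pre-Lie algebra $(\mathfrak{g},\triangleright)$ is a vector space with a bilinear product satisfying $(x\triangleright y-y\triangleright x)\triangleright z=x\triangleright(y\triangleright z)-y\triangleright(x\triangleright z)$. Set $\mathfrak{C}^0_{\mathsf{PL}}(\mathfrak{g};\mathfrak{g})=0$ and, for $n\ge1$, $\mathfrak{C}^n_{\mathsf{PL}}(\mathfrak{g};\mathfrak{g})=\bigoplus_{i=0}^{n-1}\mathrm{Hom}(\wedge^i\mathfrak{g}\otimes\wedge^{n-i}\mathfrak{g},\mathfrak{g})$. Define $\partial:\mathfrak{C}^n_{\mathsf{PL}}(\mathfrak{g};\mathfrak{g})\to\mathfrak{C}^{n+1}_{\mathsf{PL}}(\mathfrak{g};\mathfrak{g})$ by $$\partial=\sum_{k=0}^{n-2}(\partial^k_{k+1}+\partial^k_n)+\partial^{n-1}_n,$$ where $\partial^k_j:\mathrm{Hom}(\wedge^k\mathfrak{g}\otimes\wedge^{n-k}\mathfrak{g},\mathfrak{g})\to\mathrm{Hom}(\wedge^j\mathfrak{g}\otimes\wedge^{n+1-j}\mathfrak{g},\mathfrak{g})$, $j\in\{k+1,n\}$, are given as follows (hats denote omission; $\mathbb{S}_{(k,n-k)}$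 is the set of $(k,n-k)$-shuffles; $(-1)^\sigma$ is the sign of $\sigma$). For $k=0,\dots,n-2$: $$(\partial^k_{k+1}f_k)(x_1,\ldots,x_{k+1};x_{k+2},\ldots,x_{n+1})=\sum_{i=1}^{k+1}(-1)^{i-1}x_i\triangleright f_k(x_1,\ldots,\hat{x}_i,\ldots,x_{k+1};x_{k+2},\ldots,x_{n+1})$$ $$+\sum_{1\le i<j\le k+1}(-1)^{i+j}f_k(x_i\triangleright x_j-x_j\triangleright x_i,x_1,\ldots,\hat{x}_i,\ldots,\hat{x}_j,\ldots,x_{k+1};x_{k+2},\ldots,x_{n+1})$$ $$-\sum_{i=1}^{k+1}\sum_{j=k+2}^{n+1}(-1)^{i+j+k+1}f_k(x_1,\ldots,\hat{x}_i,\ldots,x_{k+1};x_i\triangleright x_j,x_{k+2},\ldots,\hat{x}_j,\ldots,x_{n+1}),$$ $$(\partial^k_nf_k)(x_1,\ldots,x_n;x_{n+1})=\sum_{\sigma\in\mathbb{S}_{(k,n-k)}}(-1)^{n-1}(-1)^\sigma f_k(x_{\sigma(1)},\ldots,x_{\sigma(k)};x_{\sigma(k+1)},\ldots,x_{\sigma(n)})\triangleright x_{n+1}.$$ And $$(\partial^{n-1}_nf_{n-1})(x_1,\ldots,x_n;x_{n+1})=\sum_{i=1}^n(-1)^{i+1}x_i\triangleright f_{n-1}(x_1,\ldots,\hat{x}_i,\ldots,x_n;x_{n+1})+\sum_{i=1}^n(-1)^{i+1}f_{n-1}(x_1,\ldots,\hat{x}_i,\ldots,x_n;x_i)\triangleright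 x_{n+1}$$ $$+\sum_{1\le i<j\le n}(-1)^{i+j}f_{n-1}(x_i\triangleright x_j-x_j\triangleright x_i,x_1,\ldots,\hat{x}_i,\ldots,\hat{x}_j,\ldots,x_n;x_{n+1})-\sum_{i=1}^n(-1)^{i+1}f_{n-1}(x_1,\ldots,\hat{x}_i,\ldots,x_n;x_i\triangleright x_{n+1}).$$ *)

theory Defs
  imports
    Complex_Main
    "HOL-Combinatorics.Permutations"
    "HOL-Library.Function_Algebras"
begin

locale cochain_complex = vector_space scale
  for scale :: "'k::field \<Rightarrow> 'v::ab_group_add \<Rightarrow> 'v" +
  fixes C :: "nat \<Rightarrow> 'v set"
    and d :: "nat \<Rightarrow> 'v \<Rightarrow> 'v"
  assumes subspace_C: "subspace (C n)"
    and d_closed: "f \<in> C n \<Longrightarrow> d n f \<in> C (Suc n)"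
    and d_add: "\<lbrakk>f \<in> C n; g \<in> C n\<rbrakk> \<Longrightarrow> d n (f + g) = d n f + d n g"
    and d_scale: "f \<in> C n \<Longrightarrow> d n (scale c f) = scale c (d n f)"
    and d_d: "f \<in> C n \<Longrightarrow> d (Suc n) (d n f) = 0"

locale pre_lie_algebra = vector_space scale
  for scale :: "'k::field_char_0 \<Rightarrow> 'a::ab_group_add \<Rightarrow> 'a" (infixr \<open>*s\<close> 75) +
  fixes pl :: "'a \<Rightarrow> 'a \<Rightarrow> 'a" (infixl \<open>\<triangleright>\<close> 80)
  assumes linear_left: "Vector_Spaces.linear scale scale (\<lambda>x. x \<triangleright> y)"
    and linear_right: "Vector_Spaces.linear scale scale (\<lambda>y. x \<triangleright> y)"
    and pre_lie: "(x \<triangleright> y - y \<triangleright> x) \<triangleright> z = x \<triangleright> (y \<triangleright> z) - y \<triangleright> (x \<triangleright> z)"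
begin

text \<open>
  A linear map on the tensor product of the \<open>p\<close>-th and the \<open>q\<close>-th exterior power of the
  algebra is given, by the universal property, as a function of a list of \<open>p\<close> and a list of
  \<open>q\<close> vectors that is multilinear and alternates in each of the two lists. It is set to \<open>0\<close>
  on lists of any other lengths, so that equality of maps is equality of functions.
\<close>

definition wedge_hom :: "nat \<Rightarrow> nat \<Rightarrow> ('a list \<Rightarrow> 'a list \<Rightarrow> 'a) set" where
  "wedge_hom p q = {f.
     (\<forall>xs ys. length xs = p \<longrightarrow> length ys = q \<longrightarrow>
        (\<forall>i<p. Vector_Spaces.linear scale scale (\<lambda>v. f (xs[i := v]) ys)) \<and>
        (\<forall>i<q. Vector_Spaces.linear scale scale (\<lambda>v. f xs (ys[i := v]))) \<and>
        (\<forall>i j. i < j \<longrightarrow> j < p \<longrightarrow> xs ! i = xs ! j \<longrightarrow> f xs ys = 0) \<and>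
        (\<forall>i j. i < j \<longrightarrow> j < q \<longrightarrow> ys ! i = ys ! j \<longrightarrow> f xs ys = 0)) \<and>
     (\<forall>xs ys. length xs \<noteq> p \<or> length ys \<noteq> q \<longrightarrow> f xs ys = 0)}"

text \<open>The direct sum over \<open>i < n\<close> is encoded as families \<open>f\<close> with \<open>f i = 0\<close> for \<open>i \<ge> n\<close>.\<close>

definition PL_cochains :: "nat \<Rightarrow> (nat \<Rightarrow> 'a list \<Rightarrow> 'a list \<Rightarrow> 'a) set" where
  "PL_cochains n = {f. (\<forall>i<n. f i \<in> wedge_hom i (n - i)) \<and> (\<forall>i\<ge>n. f i = 0)}"

text \<open>
  The arguments before the semicolon form the list \<open>xs\<close>, those after it the list \<open>ys\<close>, and
  both are counted from \<open>0\<close>; \<open>nths xs (- {i})\<close> is \<open>xs\<close> with its entry \<open>i\<close> omitted.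
  Signs agree with those for arguments numbered consecutively from \<open>1\<close>: there entry \<open>i\<close> of
  \<open>xs\<close> has number \<open>i' = i + 1\<close>, so the sign of a single index has exponent \<open>i' - 1\<close>, and in
  \<open>PL_diff_low\<close> entry \<open>j\<close> of \<open>ys\<close> has number \<open>j' = j + k + 2\<close>, so the exponent \<open>i' + j' + k + 1\<close>
  of the last sum there equals \<open>i + j + 2 * k + 4\<close>, which has the parity of \<open>i + j\<close>.
\<close>

definition PL_diff_low ::
  "nat \<Rightarrow> nat \<Rightarrow> ('a list \<Rightarrow> 'a list \<Rightarrow> 'a) \<Rightarrow> 'a list \<Rightarrow> 'a list \<Rightarrow> 'a" where
  "PL_diff_low n k f xs ys =
     (if length xs = k + 1 \<and> length ys = n - k then
        (\<Sum>i<k + 1. (-1) ^ i *s (xs ! i \<triangleright> f (nths xs (- {i})) ys))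
        + (\<Sum>j<k + 1. \<Sum>i<j. (-1) ^ (i + j) *s
             f ((xs ! i \<triangleright> xs ! j - xs ! j \<triangleright> xs ! i) # nths xs (- {i, j})) ys)
        - (\<Sum>i<k + 1. \<Sum>j<n - k. (-1) ^ (i + j) *s
             f (nths xs (- {i})) ((xs ! i \<triangleright> ys ! j) # nths ys (- {j})))
      else 0)"

definition shuffle_perms :: "nat \<Rightarrow> nat \<Rightarrow> (nat \<Rightarrow> nat) set" where
  "shuffle_perms k m = {\<sigma>. \<sigma> permutes {..<k + m} \<and>
     strict_mono_on {..<k} \<sigma> \<and> strict_mono_on {k..<k + m} \<sigma>}"

definition PL_diff_high ::
  "nat \<Rightarrow> nat \<Rightarrow> ('a list \<Rightarrow> 'a list \<Rightarrow> 'a) \<Rightarrow> 'a list \<Rightarrow> 'a list \<Rightarrow> 'a" where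
  "PL_diff_high n k f xs ys =
     (if length xs = n \<and> length ys = 1 then
        (\<Sum>\<sigma>\<in>shuffle_perms k (n - k). ((-1) ^ (n - 1) * of_int (sign \<sigma>)) *s
           (f (map (\<lambda>i. xs ! \<sigma> i) [0..<k]) (map (\<lambda>i. xs ! \<sigma> i) [k..<n]) \<triangleright> ys ! 0))
      else 0)"

definition PL_diff_top ::
  "nat \<Rightarrow> ('a list \<Rightarrow> 'a list \<Rightarrow> 'a) \<Rightarrow> 'a list \<Rightarrow> 'a list \<Rightarrow> 'a" where
  "PL_diff_top n f xs ys =
     (if length xs = n \<and> length ys = 1 then
        (\<Sum>i<n. (-1) ^ i *s (xs ! i \<triangleright> f (nths xs (- {i})) ys))
        + (\<Sum>i<n. (-1) ^ i *s (f (nths xs (- {i})) [xs ! i] \<triangleright> ys ! 0))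
        + (\<Sum>j<n. \<Sum>i<j. (-1) ^ (i + j) *s
             f ((xs ! i \<triangleright> xs ! j - xs ! j \<triangleright> xs ! i) # nths xs (- {i, j})) ys)
        - (\<Sum>i<n. (-1) ^ i *s f (nths xs (- {i})) [xs ! i \<triangleright> ys ! 0])
      else 0)"

definition PL_component ::
  "nat \<Rightarrow> ('a list \<Rightarrow> 'a list \<Rightarrow> 'a) \<Rightarrow> nat \<Rightarrow> 'a list \<Rightarrow> 'a list \<Rightarrow> 'a" where
  "PL_component j g = (\<lambda>i. if i = j then g else 0)"

text \<open>For \<open>n = 0\<close> this is \<open>0\<close>, because all sums involved are empty.\<close>

definition PL_diff ::
  "nat \<Rightarrow> (nat \<Rightarrow> 'a list \<Rightarrow> 'a list \<Rightarrow> 'a) \<Rightarrow> nat \<Rightarrow> 'a list \<Rightarrow> 'a list \<Rightarrow> 'a" where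
  "PL_diff n f =
     (\<Sum>k<n - 1. PL_component (k + 1) (PL_diff_low n k (f k)) +
                 PL_component n (PL_diff_high n k (f k)))
     + PL_component n (PL_diff_top n (f (n - 1)))"

end

end

theory Submission
  imports Defs
begin

text \<open>
  Write \<open>d\<close> for the Chevalley-Eilenberg differential of the commutator Lie algebra with
  coefficients in \<open>Hom(\<Lambda>\<^sup>m g, g)\<close>, and \<open>\<Phi>\<close> for the signed shuffle sum, which antisymmetrizes
  the two blocks of arguments into one. Then \<open>\<partial> = d + H\<close>, where, for \<open>\<Phi>f\<close> of \<open>n\<close> arguments,
  \<open>Hf(x\<^sub>1, \<dots>, x\<^sub>n; y) = (-1)\<^sup>n\<^sup>-\<^sup>1 \<Phi>f(x\<^sub>1, \<dots>, x\<^sub>n) \<triangleright> y\<close>, and \<open>d\<^sup>2 = 0\<close> because left multiplication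
  is a representation. By the pre-Lie identity, \<open>dHf + HHf = (-1)\<^sup>n\<^sup>-\<^sup>1 (d\<Phi>f) \<triangleright> y\<close>, while
  \<open>Hdf = (-1)\<^sup>n (\<Phi>df) \<triangleright> y\<close>; so everything comes down to \<open>\<Phi>d = d\<Phi>\<close>.

  Both \<open>d\<close> and \<open>\<Phi>\<close> are characterized by how they interact with inserting a vector as first
  argument (for \<open>d\<close> this is Cartan's formula \<open>\<iota>\<^sub>x d + d \<iota>\<^sub>x = L\<^sub>x\<close>). Taken as recursive definitions
  on lists, these rules absorb the signs, and the identities follow by induction on the list.
\<close>

section \<open>Shifting permutations\<close>

text \<open>The cycle through \<open>0, 1, ..., k\<close>, closing up from \<open>k\<close> to
  \<open>0\<close>, written with adjacent transpositions so that its sign follows by induction. It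
  serves to bring the first position of the second block of a shuffle to the front.\<close>

primrec cyc :: "nat \<Rightarrow> nat \<Rightarrow> nat" where
  "cyc 0 = id"
| "cyc (Suc k) = cyc k \<circ> transpose k (Suc k)"

lemma cyc_apply: "cyc k i = (if i = k then 0 else if i < k then Suc i else i)"
  by (induction k arbitrary: i) (auto simp: transpose_def)

lemma cyc_permutes: "cyc k permutes {..<Suc k}"
proof (induction k)
  case (Suc k)
  have "cyc k permutes {..<Suc (Suc k)}"
    using Suc by (rule permutes_subset) auto
  then show ?case
    unfolding cyc.simps by (rule permutes_compose[rotated]) (auto intro: permutes_swap_id)
next
  case 0
  show ?case
    unfolding cyc.simps by (rule permutes_id)
qed

lemma permutation_cyc: "permutation (cyc k)"
  using permutes_imp_permutation[OF _ cyc_permutes] by simp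

lemma sign_cyc: "sign (cyc k) = (-1) ^ k"
proof (induction k)
  case (Suc k)
  then show ?case
    unfolding cyc.simps sign_compose[OF permutation_cyc permutation_swap_id] sign_swap_id by simp
qed simp

text \<open>Embeds the permutations of \<open>n\<close> letters as the stabilizer of
  \<open>0\<close> among those of \<open>Suc n\<close> letters; this is how a shuffle grows by a new
  first argument.\<close>

definition shift :: "(nat \<Rightarrow> nat) \<Rightarrow> nat \<Rightarrow> nat" where
  "shift \<sigma> i = (case i of 0 \<Rightarrow> 0 | Suc j \<Rightarrow> Suc (\<sigma> j))"

lemma shift_simps [simp]: "shift \<sigma> 0 = 0" "shift \<sigma> (Suc j) = Suc (\<sigma> j)"
  by (simp_all add: shift_def)

lemma shift_eq_map_permutation:
  assumes "\<sigma> permutes {..<n}"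
  shows "shift \<sigma> = map_permutation {..<n} Suc \<sigma>"
proof
  fix i
  show "shift \<sigma> i = map_permutation {..<n} Suc \<sigma> i"
  proof (cases "i \<in> Suc ` {..<n}")
    case True
    then show ?thesis
      by (auto simp: map_permutation_apply)
  next
    case False
    then show ?thesis
      using permutes_not_in[OF assms]
      by (cases i) (auto simp: map_permutation_def restrict_id_def)
  qed
qed

lemma shift_permutes:
  assumes "\<sigma> permutes {..<n}"
  shows "shift \<sigma> permutes {..<Suc n}"
proof -
  have "shift \<sigma> permutes Suc ` {..<n}"
    unfolding shift_eq_map_permutation[OF assms]
    by (rule map_permutation_permutes) (use assms in \<open>auto simp: bij_betw_def\<close>)
  then show ?thesis
    by (rule permutes_subset) auto
qed

lemma sign_shift: "\<sigma> permutes {..<n} \<Longrightarrow> sign (shift \<sigma>) = sign \<sigma>"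
  by (simp add: shift_eq_map_permutation sign_map_permutation)

lemma shift_surj:
  assumes "\<rho> permutes {..<Suc n}" "\<rho> 0 = 0"
  obtains \<sigma> where "\<sigma> permutes {..<n}" "\<rho> = shift \<sigma>"
proof
  \<comment> \<open>Injectivity keeps the images of positive indices positive, so subtracting
    \<open>1\<close> from them is never truncated.\<close>
  have nz: "\<rho> (Suc i) \<noteq> 0" for i
    using assms permutes_inj[OF assms(1)] by (metis injD nat.distinct(1))
  have 1: "\<rho> permutes Suc ` {..<n}"
  proof (rule permutes_superset[OF assms(1)])
    show "\<rho> x = x" if "x \<in> {..<Suc n} - Suc ` {..<n}" for x
      using that assms(2) by (cases x) auto
  qed
  show "map_permutation (Suc ` {..<n}) (\<lambda>i. i - 1) \<rho> permutes {..<n}"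
    by (rule map_permutation_permutes[OF _ 1])
      (auto simp: bij_betw_def inj_on_def image_image)
  show "\<rho> = shift (map_permutation (Suc ` {..<n}) (\<lambda>i. i - 1) \<rho>)"
  proof
    fix i
    show "\<rho> i = shift (map_permutation (Suc ` {..<n}) (\<lambda>i. i - 1) \<rho>) i"
    proof (cases i)
      case (Suc j)
      show ?thesis
      proof (cases "j < n")
        case True
        then have "map_permutation (Suc ` {..<n}) (\<lambda>i. i - 1) \<rho> (Suc j - 1) = \<rho> (Suc j) - 1"
          by (intro map_permutation_apply) (auto simp: inj_on_def)
        then show ?thesis
          using Suc nz[of j] by simp
      next
        case False
        then show ?thesis
          using permutes_not_in[OF assms(1), of "Suc j"] Suc
          by (auto simp: map_permutation_def restrict_id_def image_image)
      qed
    qed (simp add: assms(2))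
  qed
qed

context pre_lie_algebra
begin

section \<open>Multilinear and alternating functions of lists\<close>

abbreviation lin :: "('a \<Rightarrow> 'a) \<Rightarrow> bool"
  where "lin \<equiv> Vector_Spaces.linear scale scale"

lemma lin_iff: "lin h \<longleftrightarrow> (\<forall>x y. h (x + y) = h x + h y) \<and> (\<forall>c x. h (c *s x) = c *s h x)"
  using vector_space_axioms by (simp add: Vector_Spaces.linear_iff)

lemma lin_zero [intro]: "lin (\<lambda>x. 0)"
  by (simp add: lin_iff)

lemma lin_ident [intro]: "lin (\<lambda>x. x)"
  by (simp add: lin_iff)

lemma lin_add [intro]: "lin f \<Longrightarrow> lin g \<Longrightarrow> lin (\<lambda>x. f x + g x)"
  by (simp add: lin_iff scale_right_distrib)

lemma lin_uminus [intro]: "lin f \<Longrightarrow> lin (\<lambda>x. - f x)"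
  by (simp add: lin_iff)

lemma lin_diff [intro]: "lin f \<Longrightarrow> lin g \<Longrightarrow> lin (\<lambda>x. f x - g x)"
  by (simp add: lin_iff scale_right_diff_distrib)

lemma lin_scale [intro]: "lin f \<Longrightarrow> lin (\<lambda>x. c *s f x)"
  by (simp add: lin_iff scale_right_distrib mult.commute)

lemma lin_comp: "lin h \<Longrightarrow> lin f \<Longrightarrow> lin (\<lambda>x. h (f x))"
  by (simp add: lin_iff)

lemma pl_left [intro]: "lin f \<Longrightarrow> lin (\<lambda>x. f x \<triangleright> y)"
  using lin_comp[OF linear_left] .

lemma pl_right [intro]: "lin f \<Longrightarrow> lin (\<lambda>x. y \<triangleright> f x)"
  using lin_comp[OF linear_right] .

lemma pl_simps:
  "(x + y) \<triangleright> z = x \<triangleright> z + y \<triangleright> z" "x \<triangleright> (y + z) = x \<triangleright> y + x \<triangleright> z"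
  "(x - y) \<triangleright> z = x \<triangleright> z - y \<triangleright> z" "x \<triangleright> (y - z) = x \<triangleright> y - x \<triangleright> z"
  "(- x) \<triangleright> z = - (x \<triangleright> z)" "x \<triangleright> (- z) = - (x \<triangleright> z)"
  "(c *s x) \<triangleright> z = c *s (x \<triangleright> z)" "x \<triangleright> (c *s z) = c *s (x \<triangleright> z)"
  "0 \<triangleright> z = 0" "x \<triangleright> 0 = 0"
proof -
  interpret l: Vector_Spaces.linear scale scale "\<lambda>x. x \<triangleright> z" for z
    by (rule linear_left)
  interpret r: Vector_Spaces.linear scale scale "\<lambda>y. x \<triangleright> y" for x
    by (rule linear_right)
  show "(x + y) \<triangleright> z = x \<triangleright> z + y \<triangleright> z" "(x - y) \<triangleright> z = x \<triangleright> z - y \<triangleright> z"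
    "(- x) \<triangleright> z = - (x \<triangleright> z)" "(c *s x) \<triangleright> z = c *s (x \<triangleright> z)" "0 \<triangleright> z = 0"
    by (rule l.add l.diff l.neg l.scale l.zero)+
  show "x \<triangleright> (y + z) = x \<triangleright> y + x \<triangleright> z" "x \<triangleright> (y - z) = x \<triangleright> y - x \<triangleright> z"
    "x \<triangleright> (- z) = - (x \<triangleright> z)" "x \<triangleright> (c *s z) = c *s (x \<triangleright> z)" "x \<triangleright> 0 = 0"
    by (rule r.add r.diff r.neg r.scale r.zero)+
qed

lemma pl_sum_left: "(\<Sum>i\<in>I. f i) \<triangleright> z = (\<Sum>i\<in>I. f i \<triangleright> z)"
  by (induction I rule: infinite_finite_induct) (auto simp: pl_simps)

section \<open>The commutator bracket\<close>

definition br :: "'a \<Rightarrow> 'a \<Rightarrow> 'a"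
  where "br x y = x \<triangleright> y - y \<triangleright> x"

lemma lin_br_right [intro]: "lin f \<Longrightarrow> lin (\<lambda>y. br x (f y))"
  unfolding br_def by (intro lin_diff pl_left pl_right)

lemma lin_br_left [intro]: "lin f \<Longrightarrow> lin (\<lambda>x. br (f x) y)"
  unfolding br_def by (intro lin_diff pl_left pl_right)

lemma lin_partial [intro]: "lin (br x)" "lin ((\<triangleright>) x)"
  using lin_br_right[OF lin_ident, of x] linear_right[of x] by simp_all

lemma br_pl: "br x y \<triangleright> z = x \<triangleright> (y \<triangleright> z) - y \<triangleright> (x \<triangleright> z)"
  by (simp add: br_def pre_lie)

lemma br_self [simp]: "br x x = 0"
  by (simp add: br_def)

lemma br_minus: "br y x = - br x y"
  by (simp add: br_def)

lemma jacobi: "br x (br y z) - br y (br x z) = br (br x y) z"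
proof -
  have "br u v = u \<triangleright> v - v \<triangleright> u" for u v
    by (rule br_def)
  \<comment> \<open>Brackets that multiply from the left are kept, so that \<open>br_pl\<close>
    applies to them; all others are expanded.\<close>
  then have "br x (br y z) = x \<triangleright> (y \<triangleright> z - z \<triangleright> y) - br y z \<triangleright> x"
    "br y (br x z) = y \<triangleright> (x \<triangleright> z - z \<triangleright> x) - br x z \<triangleright> y"
    "br (br x y) z = br x y \<triangleright> z - z \<triangleright> (x \<triangleright> y - y \<triangleright> x)"
    by metis+
  then show ?thesis
    by (simp only: br_pl pl_simps) (simp add: algebra_simps)
qed

text \<open>Demanded at every list length: a map of fixed arity is extended by \<open>0\<close>, and
  the class is then closed under fixing the first argument and under adding maps of different
  arities.\<close>

definition mlin :: "('a list \<Rightarrow> 'a) \<Rightarrow> bool"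
  where "mlin g \<longleftrightarrow> (\<forall>us vs. lin (\<lambda>v. g (us @ v # vs)))"

definition alt :: "('a list \<Rightarrow> 'a) \<Rightarrow> bool"
  where "alt g \<longleftrightarrow> (\<forall>us v vs. g (us @ v # v # vs) = 0)"

lemma mlinD: "mlin g \<Longrightarrow> lin (\<lambda>v. g (us @ v # vs))"
  by (simp add: mlin_def)

lemma mlin_hd: "mlin g \<Longrightarrow> lin (\<lambda>v. g (v # vs))"
  using mlinD[of g "[]"] by simp

lemma mlin_Cons [intro]: "mlin g \<Longrightarrow> mlin (\<lambda>us. g (x # us))"
  using mlinD[of g "x # us" vs for us vs] by (simp add: mlin_def)

lemma altD: "alt g \<Longrightarrow> g (us @ v # v # vs) = 0"
  by (simp add: alt_def)

lemma alt_hd: "alt g \<Longrightarrow> g (v # v # vs) = 0"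
  using altD[of g "[]"] by simp

lemma alt_Cons [intro]: "alt g \<Longrightarrow> alt (\<lambda>us. g (x # us))"
  using altD[of g "x # us" v vs for us v vs] by (simp add: alt_def)

text \<open>Polarization: expand \<open>g\<close> with \<open>a + b\<close> in both adjacent
  places.\<close>

lemma alt_swap:
  assumes "mlin g" "alt g"
  shows "g (us @ a # b # vs) = - g (us @ b # a # vs)"
proof -
  have add1: "g (us @ (u + v) # ws) = g (us @ u # ws) + g (us @ v # ws)" for u v ws us
    using mlinD[OF assms(1), of us ws] by (simp add: lin_iff)
  have add2: "g (us @ w # (u + v) # ws) = g (us @ w # u # ws) + g (us @ w # v # ws)" for w u v ws
    using add1[of "us @ [w]"] by simp
  have "g (us @ a # b # vs) + g (us @ b # a # vs) = g (us @ (a + b) # (a + b) # vs)"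
    by (simp only: add1 add2) (simp only: altD[OF assms(2)] add_0_left add_0_right)
  also have "\<dots> = 0"
    by (rule altD[OF assms(2)])
  finally show ?thesis
    by (simp only: eq_neg_iff_add_eq_0)
qed

lemma alt_swap_hd: "mlin g \<Longrightarrow> alt g \<Longrightarrow> g (a # b # vs) = - g (b # a # vs)"
  by (rule alt_swap[of g "[]", unfolded append_Nil])

definition bialt :: "('a list \<Rightarrow> 'a list \<Rightarrow> 'a) \<Rightarrow> bool"
  where "bialt f \<longleftrightarrow> (\<forall>vs. mlin (\<lambda>us. f us vs) \<and> alt (\<lambda>us. f us vs)) \<and> (\<forall>us. mlin (f us) \<and> alt (f us))"

lemma bialt_mlin: "bialt f \<Longrightarrow> mlin (\<lambda>us. f us vs)" "bialt f \<Longrightarrow> mlin (f us)"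
  and bialt_alt: "bialt f \<Longrightarrow> alt (\<lambda>us. f us vs)" "bialt f \<Longrightarrow> alt (f us)"
  by (auto simp: bialt_def)

lemma bialtD_lin:
  assumes "bialt f"
  shows "lin (\<lambda>v. f (us @ v # us') vs)" "lin (\<lambda>v. f us (vs @ v # vs'))"
    "lin (\<lambda>v. f (v # us') vs)" "lin (\<lambda>v. f us (v # vs'))"
  using assms mlinD[of "\<lambda>us. f us vs"] mlinD[of "f us"]
    mlin_hd[of "\<lambda>us. f us vs"] mlin_hd[of "f us"] by (auto simp: bialt_def)

lemma bialtD_alt:
  assumes "bialt f"
  shows "f (us @ v # v # us') vs = 0" "f us (vs @ v # v # vs') = 0"
    "f (v # v # us') vs = 0" "f us (v # v # vs') = 0"
  using assms alt_hd[of "\<lambda>us. f us vs"] alt_hd[of "f us"]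
  by (auto simp: bialt_def alt_def)

lemma bialt_Cons1 [intro]: "bialt f \<Longrightarrow> bialt (\<lambda>us. f (x # us))"
  unfolding bialt_def by (auto intro: mlin_Cons alt_Cons)

lemma bialt_Cons2 [intro]: "bialt f \<Longrightarrow> bialt (\<lambda>us vs. f us (x # vs))"
  unfolding bialt_def by (auto intro: mlin_Cons alt_Cons)

lemma bialt_add [intro]: "bialt f \<Longrightarrow> bialt g \<Longrightarrow> bialt (\<lambda>us vs. f us vs + g us vs)"
  by (auto simp: bialt_def mlin_def alt_def)

lemma bialt_length_scale [intro]: "bialt f \<Longrightarrow> bialt (\<lambda>us vs. c (length us) *s f us vs)"
  by (auto simp: bialt_def mlin_def alt_def)

lemma bialt_zero [intro]: "bialt (\<lambda>us vs. 0)"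
  by (auto simp: bialt_def mlin_def alt_def)

lemma bialt_sum [intro]: "(\<And>i. i \<in> I \<Longrightarrow> bialt (f i)) \<Longrightarrow> bialt (\<lambda>us vs. \<Sum>i\<in>I. f i us vs)"
  by (induction I rule: infinite_finite_induct) auto

section \<open>The Lie algebra action and the Chevalley-Eilenberg differential\<close>

text \<open>The action of \<open>t\<close> as a derivation of tensors, transposed to functions: each
  entry in turn is replaced by its image and the results are added. Taking \<open>g\<close> as an
  argument lets the recursion absorb the head of the list into it.\<close>

fun der :: "('a \<Rightarrow> 'a) \<Rightarrow> 'a list \<Rightarrow> ('a list \<Rightarrow> 'a) \<Rightarrow> 'a" where
  "der t [] g = 0"
| "der t (x # xs) g = g (t x # xs) + der t xs (\<lambda>zs. g (x # zs))"

lemma der_zero [simp]: "der t xs (\<lambda>zs. 0) = 0"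
  by (induction xs) auto

lemma der_add: "der t xs (\<lambda>zs. f zs + g zs) = der t xs f + der t xs g"
  by (induction xs arbitrary: f g) auto

lemma der_lin_comp:
  assumes "lin h"
  shows "der t xs (\<lambda>zs. h (g zs)) = h (der t xs g)"
proof -
  interpret Vector_Spaces.linear scale scale h by fact
  show ?thesis
    by (induction xs arbitrary: g) (auto simp: add zero)
qed

lemma der_uminus: "der t xs (\<lambda>zs. - g zs) = - der t xs g"
  by (rule der_lin_comp) auto

lemma der_scale: "der t xs (\<lambda>zs. c *s g zs) = c *s der t xs g"
  by (rule der_lin_comp) auto

lemma der_diff: "der t xs (\<lambda>zs. f zs - g zs) = der t xs f - der t xs g"
  using der_add[of t xs f "\<lambda>zs. - g zs"] by (simp add: der_uminus)

lemma der_pl_left: "der t xs (\<lambda>zs. g zs \<triangleright> y) = der t xs g \<triangleright> y"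
  by (rule der_lin_comp) auto

lemma der_pl_right: "der t xs (\<lambda>zs. y \<triangleright> g zs) = y \<triangleright> der t xs g"
  by (rule der_lin_comp) auto

lemma der_length_scale: "der t xs (\<lambda>zs. c (length zs) *s g zs) = c (length xs) *s der t xs g"
  by (induction xs arbitrary: g c) (auto simp: scale_right_distrib)

lemma der_exchange:
  "der s xs (\<lambda>us. der t ys (f us)) = der t ys (\<lambda>vs. der s xs (\<lambda>us. f us vs))"
  by (induction xs arbitrary: f) (auto simp: der_add)

lemma lin_der_param: "(\<And>zs. lin (\<lambda>v. G v zs)) \<Longrightarrow> lin (\<lambda>v. der t xs (G v))"
  by (induction xs arbitrary: G) auto

lemma lin_der_map:
  assumes "\<And>y. lin (\<lambda>v. T v y)" "mlin g"
  shows "lin (\<lambda>v. der (T v) xs g)"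
  using assms(2)
proof (induction xs arbitrary: g)
  case (Cons x xs)
  have "lin (\<lambda>v. g (T v x # xs))"
    using lin_comp[OF mlin_hd[OF Cons.prems] assms(1)] .
  then show ?case
    using Cons.IH[OF mlin_Cons[OF Cons.prems]] by auto
qed auto

lemma der_map_add:
  assumes "mlin g"
  shows "der (\<lambda>x. s x + t x) xs g = der s xs g + der t xs g"
  using assms
proof (induction xs arbitrary: g)
  case (Cons x xs)
  then show ?case
    using mlin_hd[of g xs] by (auto simp: lin_iff mlin_Cons)
qed auto

text \<open>Replacements at different positions commute, so only the terms in which both maps hit
  the same entry survive. The order is reversed because \<open>der\<close> acts by
  precomposition.\<close>

lemma der_commute:
  assumes "mlin g"
  shows "der s xs (\<lambda>zs. der t zs g) - der t xs (\<lambda>zs. der s zs g)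
       = der (\<lambda>x. t (s x) - s (t x)) xs g"
  using assms
proof (induction xs arbitrary: g)
  case (Cons x xs)
  interpret g: Vector_Spaces.linear scale scale "\<lambda>v. g (v # xs)"
    by (rule mlin_hd) fact
  show ?case
    using Cons.IH[OF mlin_Cons[OF Cons.prems, of x]]
    by (simp add: der_add g.diff algebra_simps)
qed auto

lemma mlin_der:
  assumes "lin t" "mlin g"
  shows "mlin (\<lambda>xs. der t xs g)"
proof -
  have "lin (\<lambda>v. der t (us @ v # vs) g)" for us vs
    using assms(2)
  proof (induction us arbitrary: g)
    case Nil
    have "lin (\<lambda>v. g (t v # vs))"
      using lin_comp[OF mlin_hd[OF Nil] assms(1)] .
    moreover have "lin (\<lambda>v. der t vs (\<lambda>zs. g (v # zs)))"
      by (rule lin_der_param) (rule mlin_hd[OF Nil])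
    ultimately show ?case
      by auto
  next
    case (Cons u us)
    then show ?case
      using mlinD[of g "t u # us" vs] by (auto simp: mlin_Cons)
  qed
  then show ?thesis
    by (simp add: mlin_def)
qed

text \<open>Replacing either of two equal neighbours gives two terms that cancel by antisymmetry; in
  all other terms the equal neighbours survive.\<close>

lemma alt_der:
  assumes "mlin g" "alt g"
  shows "alt (\<lambda>xs. der t xs g)"
proof -
  have "der t (us @ v # v # vs) g = 0" for us v vs
    using assms
  proof (induction us arbitrary: g)
    case Nil
    then show ?case
      using alt_swap_hd[of g "t v" v vs] by (simp add: alt_hd)
  next
    case (Cons u us)
    then have "g ((t u # us) @ v # v # vs) = 0"
      unfolding alt_def by blast
    with Cons show ?case
      by (simp add: mlin_Cons alt_Cons)
  qed
  then show ?thesis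
    by (simp add: alt_def)
qed

text \<open>The Lie derivative along \<open>x\<close>. The first block holds the arguments of a
  Chevalley-Eilenberg cochain, so \<open>x\<close> acts there by the bracket; the second block
  belongs to the coefficients, so there, as on values, \<open>x\<close> acts by left
  multiplication.\<close>

definition lie :: "'a \<Rightarrow> ('a list \<Rightarrow> 'a list \<Rightarrow> 'a) \<Rightarrow> 'a list \<Rightarrow> 'a list \<Rightarrow> 'a" where
  "lie x f us vs = x \<triangleright> f us vs - der (br x) us (\<lambda>us. f us vs) - der ((\<triangleright>) x) vs (f us)"

lemma lie_Cons1: "lie x f (y # us) vs = lie x (\<lambda>us. f (y # us)) us vs - f (br x y # us) vs"
  by (simp add: lie_def)

lemma lie_Cons2:
  "lie x f us (y # vs) = lie x (\<lambda>us vs. f us (y # vs)) us vs - f us (x \<triangleright> y # vs)"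
  by (simp add: lie_def)

lemma lie_add: "lie x (\<lambda>us vs. f us vs + g us vs) us vs = lie x f us vs + lie x g us vs"
  by (simp add: lie_def der_add pl_simps)

lemma lie_diff: "lie x (\<lambda>us vs. f us vs - g us vs) us vs = lie x f us vs - lie x g us vs"
  by (simp add: lie_def der_diff pl_simps)

lemma lie_length_scale:
  "lie x (\<lambda>us vs. c (length us) *s f us vs) us vs = c (length us) *s lie x f us vs"
  using der_length_scale[of "br x" us c "\<lambda>us. f us vs"]
  by (simp add: lie_def der_scale pl_simps algebra_simps)

lemma lin_lie_param:
  "(\<And>us vs. lin (\<lambda>v. F v us vs)) \<Longrightarrow> lin (\<lambda>v. lie x (F v) us vs)"
  unfolding lie_def by (intro lin_diff pl_right lin_der_param) auto

lemma lin_lie: "bialt f \<Longrightarrow> lin (\<lambda>x. lie x f us vs)"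
  unfolding lie_def by (intro lin_diff lin_der_map) (auto simp: bialt_def linear_left)

lemma mlin_diff: "mlin f \<Longrightarrow> mlin g \<Longrightarrow> mlin (\<lambda>us. f us - g us)"
  by (auto simp: mlin_def)

lemma mlin_lin_comp: "lin h \<Longrightarrow> mlin f \<Longrightarrow> mlin (\<lambda>us. h (f us))"
  by (auto simp: mlin_def intro: lin_comp)

lemma mlin_der_param: "(\<And>zs. mlin (\<lambda>us. G us zs)) \<Longrightarrow> mlin (\<lambda>us. der t xs (G us))"
  by (auto simp: mlin_def intro: lin_der_param)

lemma alt_der_param: "(\<And>zs. alt (\<lambda>us. G us zs)) \<Longrightarrow> alt (\<lambda>us. der t xs (G us))"
proof -
  have "G us = (\<lambda>zs. 0) \<Longrightarrow> der t xs (G us) = 0" for us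
    by simp
  then show "(\<And>zs. alt (\<lambda>us. G us zs)) \<Longrightarrow> ?thesis"
    unfolding alt_def by blast
qed

lemma alt_diff: "alt f \<Longrightarrow> alt g \<Longrightarrow> alt (\<lambda>us. f us - g us)"
  by (auto simp: alt_def)

lemma alt_pl: "alt f \<Longrightarrow> alt (\<lambda>us. x \<triangleright> f us)"
  by (auto simp: alt_def pl_simps)

lemma bialt_lie [intro]:
  assumes "bialt f"
  shows "bialt (lie x f)"
  unfolding bialt_def lie_def
  using assms
  by (intro allI conjI mlin_diff alt_diff alt_pl mlin_lin_comp[OF linear_right] mlin_der alt_der
      mlin_der_param alt_der_param)
    (auto simp: bialt_def)

text \<open>The actions on the values, on the first block and on the second block commute with one
  another, and each is a representation: for the first block by \<open>jacobi\<close>, for the other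
  two by the pre-Lie identity.\<close>

lemma lie_commute:
  assumes "bialt f"
  shows "lie x (lie y f) us vs - lie y (lie x f) us vs = lie (br x y) f us vs"
proof -
  have 1: "der (br x) us (\<lambda>zs. der (br y) zs (\<lambda>us. f us vs))
         - der (br y) us (\<lambda>zs. der (br x) zs (\<lambda>us. f us vs))
         = - der (br (br x y)) us (\<lambda>us. f us vs)" (is "?L1 - ?R1 = - ?B1")
  proof -
    have "(\<lambda>z. br y (br x z) - br x (br y z)) = (\<lambda>z. br (br y x) z)"
      using jacobi by auto
    moreover have "der (\<lambda>z. br (br y x) z) us (\<lambda>us. f us vs) = - der (br (br x y)) us (\<lambda>us. f us vs)"
    proof -
      interpret Vector_Spaces.linear scale scale "\<lambda>v. der (br v) us (\<lambda>us. f us vs)"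
        by (rule lin_der_map) (use assms in \<open>auto simp: bialt_def\<close>)
      show ?thesis
        using neg[of "br x y"] by (simp add: br_minus[of y x])
    qed
    ultimately show ?thesis
      using der_commute[OF bialt_mlin(1)[OF assms], of "br x" us "br y" vs] by simp
  qed
  have 2: "der ((\<triangleright>) x) vs (\<lambda>zs. der ((\<triangleright>) y) zs (f us))
         - der ((\<triangleright>) y) vs (\<lambda>zs. der ((\<triangleright>) x) zs (f us))
         = - der ((\<triangleright>) (br x y)) vs (f us)" (is "?L2 - ?R2 = - ?B2")
  proof -
    have "(\<lambda>z. y \<triangleright> (x \<triangleright> z) - x \<triangleright> (y \<triangleright> z)) = (\<lambda>z. br y x \<triangleright> z)"
      using br_pl by auto
    moreover have "der (\<lambda>z. br y x \<triangleright> z) vs (f us) = - der ((\<triangleright>) (br x y)) vs (f us)"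
    proof -
      interpret Vector_Spaces.linear scale scale "\<lambda>v. der ((\<triangleright>) v) vs (f us)"
        by (rule lin_der_map) (use assms in \<open>auto simp: bialt_def\<close>)
      show ?thesis
        using neg[of "br x y"] by (simp add: br_minus[of y x])
    qed
    ultimately show ?thesis
      using der_commute[OF bialt_mlin(2)[OF assms], of "(\<triangleright>) x" vs "(\<triangleright>) y" us] by simp
  qed
  show ?thesis
    by (simp add: 1[unfolded diff_eq_eq] 2[unfolded diff_eq_eq] lie_def[abs_def] der_add der_diff der_pl_right pl_simps br_pl algebra_simps
        der_exchange[of "br x" us "(\<triangleright>) y" vs f] der_exchange[of "br y" us "(\<triangleright>) x" vs f])
qed

text \<open>Cartan's formula \<open>\<iota>\<^sub>x d + d \<iota>\<^sub>x = L\<^sub>x\<close>, solved for \<open>\<iota>\<^sub>x d\<close>.\<close>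

fun ce :: "('a list \<Rightarrow> 'a list \<Rightarrow> 'a) \<Rightarrow> 'a list \<Rightarrow> 'a list \<Rightarrow> 'a" where
  "ce f [] = (\<lambda>vs. 0)"
| "ce f (x # us) = (\<lambda>vs. lie x f us vs - ce (\<lambda>us. f (x # us)) us vs)"

lemma ce_add: "ce (\<lambda>us vs. f us vs + g us vs) us vs = ce f us vs + ce g us vs"
  by (induction us arbitrary: f g) (auto simp: lie_add)

lemma ce_diff: "ce (\<lambda>us vs. f us vs - g us vs) us vs = ce f us vs - ce g us vs"
  by (induction us arbitrary: f g) (auto simp: lie_diff)

lemma lie_zero [simp]: "lie x (\<lambda>us vs. 0) us vs = 0"
  by (simp add: lie_def pl_simps)

lemma ce_zero [simp]: "ce (\<lambda>us vs. 0) us vs = 0"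
  by (induction us) auto

lemma ce_sum: "ce (\<lambda>us vs. \<Sum>i\<in>I. f i us vs) us vs = (\<Sum>i\<in>I. ce (f i) us vs)"
  by (induction I rule: infinite_finite_induct) (auto simp: ce_add)

text \<open>\<open>ce\<close> evaluates its argument on first blocks that are one entry shorter,
  hence the extra minus sign.\<close>

lemma ce_sign:
  "ce (\<lambda>us vs. (-1) ^ length us *s f us vs) us vs = - ((-1) ^ length us *s ce f us vs)"
proof (induction us arbitrary: f)
  case (Cons x us)
  \<comment> \<open>The negation is written as a difference from \<open>0\<close> to make
    \<open>ce_diff\<close> applicable.\<close>
  have "ce (\<lambda>us vs. (- 1) ^ length (x # us) *s f (x # us) vs) us vs
      = ce (\<lambda>us vs. 0 - (- 1) ^ length us *s f (x # us) vs) us vs"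
    by simp
  also have "\<dots> = (- 1) ^ length us *s ce (\<lambda>us. f (x # us)) us vs"
    unfolding ce_diff Cons.IH by simp
  finally show ?case
    using lie_length_scale[of x "\<lambda>n. (-1) ^ n" f us vs] by (simp add: algebra_simps)
qed auto

lemma lin_ce_param:
  "(\<And>us vs. lin (\<lambda>v. F v us vs)) \<Longrightarrow> lin (\<lambda>v. ce (F v) us vs)"
  by (induction us arbitrary: F) (auto intro!: lin_diff lin_lie_param)

text \<open>Alternation at the head: unfolding \<open>ce\<close> twice on \<open>v # v # us'\<close>
  yields the same Lie derivative with both signs. What remains contains \<open>br v v = 0\<close> or
  \<open>v\<close> twice at the head of the arguments of \<open>f\<close>.\<close>

lemma bialt_ce [intro]:
  assumes "bialt f"
  shows "bialt (ce f)"
proof -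
  have "lin (\<lambda>v. ce f (us @ v # us') vs)" for us us' vs
    using assms
  proof (induction us arbitrary: f)
    case Nil
    have "lin (\<lambda>v. ce (\<lambda>us. f (v # us)) us' vs)"
      by (rule lin_ce_param) (rule bialtD_lin(3)[OF Nil])
    with lin_lie[OF Nil] show ?case
      by auto
  next
    case (Cons u us)
    then show ?case
      using bialtD_lin(1)[OF bialt_lie[OF Cons.prems], of u us us' vs] Cons.IH[OF bialt_Cons1[OF Cons.prems]] by auto
  qed
  moreover have "ce f (us @ v # v # us') vs = 0" for us us' v vs
    using assms
  proof (induction us arbitrary: f)
    case Nil
    have "f (0 # us') vs = 0"
      using bialtD_lin(3)[OF Nil, of us' vs] by (metis lin_iff scale_zero_left)
    moreover have "(\<lambda>us. f (v # v # us)) = (\<lambda>us vs. 0)"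
      using bialtD_alt(3)[OF Nil] by (simp add: fun_eq_iff)
    ultimately show ?case
      by (simp add: lie_Cons1)
  next
    case (Cons u us)
    then show ?case
      using bialtD_alt(1)[OF bialt_lie[OF Cons.prems], of u us v us' vs] by auto
  qed
  moreover have "lin (\<lambda>v. ce f us (vs @ v # vs'))" for us vs vs'
    using assms
  proof (induction us arbitrary: f)
    case (Cons u us)
    then show ?case
      using bialtD_lin(2)[OF bialt_lie[OF Cons.prems], of u us] Cons.IH[OF bialt_Cons1[OF Cons.prems]] by auto
  qed auto
  moreover have "ce f us (vs @ v # v # vs') = 0" for us v vs vs'
    using assms
  proof (induction us arbitrary: f)
    case (Cons u us)
    then show ?case
      using bialtD_alt(2)[OF bialt_lie[OF Cons.prems], of u us vs v vs'] by auto
  qed auto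
  ultimately show ?thesis
    by (simp add: bialt_def mlin_def alt_def)
qed

text \<open>Induction on the first block, using Cartan's formula, the relation
  \<open>lie_Cons1\<close> between the Lie derivative along \<open>x\<close> and insertion of
  \<open>y\<close>, which produces an insertion of \<open>br x y\<close>, and
  \<open>lie_commute\<close>.\<close>

lemma lie_ce:
  assumes "bialt f"
  shows "lie x (ce f) us vs = ce (lie x f) us vs"
  using assms
proof (induction us arbitrary: f)
  case Nil
  show ?case
    by (simp add: lie_def pl_simps)
next
  case (Cons y us)
  have "lie x (ce f) (y # us) vs = lie x (lie y f) us vs - lie x (ce (\<lambda>us. f (y # us))) us vs
      - (lie (br x y) f us vs - ce (\<lambda>us. f (br x y # us)) us vs)"
    by (simp add: lie_Cons1 lie_diff)
  also have "\<dots> = lie y (lie x f) us vs - ce (lie x (\<lambda>us. f (y # us))) us vs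
      + ce (\<lambda>us. f (br x y # us)) us vs"
    using lie_commute[OF Cons.prems, of x y us vs] Cons.IH[OF bialt_Cons1[OF Cons.prems, of y]]
    by (simp add: algebra_simps)
  also have "\<dots> = ce (lie x f) (y # us) vs"
    using lie_Cons1[of x f y, abs_def] by (simp add: ce_diff)
  finally show ?case .
qed

text \<open>Since the Lie derivative commutes with \<open>ce\<close>, applying Cartan's formula
  twice gives \<open>\<iota>\<^sub>x d d = d d \<iota>\<^sub>x\<close>; so the square can be pushed
  down to the empty block, where it vanishes.\<close>

lemma ce_ce:
  assumes "bialt f"
  shows "ce (ce f) us vs = 0"
  using assms
proof (induction us arbitrary: f)
  case (Cons x us)
  then show ?case
    by (simp add: lie_ce ce_diff bialt_Cons1)
qed auto

section \<open>Shuffle sums\<close>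

text \<open>
  In a shuffle of \<open>x # xs\<close>, the vector \<open>x\<close> comes first in one of the two blocks; putting it at the
  head of the second one moves it past the whole first block.
\<close>

definition ins :: "'a \<Rightarrow> ('a list \<Rightarrow> 'a list \<Rightarrow> 'a) \<Rightarrow> 'a list \<Rightarrow> 'a list \<Rightarrow> 'a" where
  "ins x f us vs = f (x # us) vs + (-1) ^ length us *s f us (x # vs)"

lemma ins_eq: "ins x f = (\<lambda>us vs. f (x # us) vs + (-1) ^ length us *s f us (x # vs))"
  by (simp add: ins_def fun_eq_iff)

text \<open>The map \<open>\<Phi>\<close>. No block sizes are prescribed: all ways to split the list
  are summed, and an \<open>f\<close> supported on one pair of lengths selects its own
  shuffles.\<close>

fun shuf :: "('a list \<Rightarrow> 'a list \<Rightarrow> 'a) \<Rightarrow> 'a list \<Rightarrow> 'a" where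
  "shuf f [] = f [] []"
| "shuf f (x # xs) = shuf (ins x f) xs"

text \<open>
  The failure of \<open>ce\<close> to commute with insertion of \<open>x\<close> into the second block: the alternating sum
  over the terms in which an entry \<open>z\<close> of the first block leaves it, turning \<open>x\<close> into \<open>z \<triangleright> x\<close>.
\<close>

fun move :: "'a \<Rightarrow> ('a list \<Rightarrow> 'a list \<Rightarrow> 'a) \<Rightarrow> 'a list \<Rightarrow> 'a list \<Rightarrow> 'a" where
  "move x f [] = (\<lambda>vs. 0)"
| "move x f (z # us) = (\<lambda>vs. f us (z \<triangleright> x # vs) - move x (\<lambda>us. f (z # us)) us vs)"

lemma bialt_ins [intro]: "bialt f \<Longrightarrow> bialt (ins x f)"
  unfolding ins_def by (intro bialt_add bialt_length_scale) auto

lemma ins_add: "ins x (\<lambda>us vs. f us vs + g us vs) = (\<lambda>us vs. ins x f us vs + ins x g us vs)"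
  by (simp add: ins_eq fun_eq_iff scale_right_distrib)

lemma shuf_add: "shuf (\<lambda>us vs. f us vs + g us vs) xs = shuf f xs + shuf g xs"
  by (induction xs arbitrary: f g) (auto simp: ins_add)

lemma ins_scale: "ins x (\<lambda>us vs. c *s f us vs) = (\<lambda>us vs. c *s ins x f us vs)"
  by (simp add: ins_eq fun_eq_iff scale_right_distrib mult.commute)

lemma shuf_scale: "shuf (\<lambda>us vs. c *s f us vs) xs = c *s shuf f xs"
  by (induction xs arbitrary: f) (auto simp: ins_scale)

lemma shuf_diff: "shuf (\<lambda>us vs. f us vs - g us vs) xs = shuf f xs - shuf g xs"
  using shuf_add[of f "\<lambda>us vs. (-1) *s g us vs" xs] shuf_scale[of "-1" g xs] by simp

lemma shuf_zero [simp]: "shuf (\<lambda>us vs. 0) xs = 0"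
  using shuf_scale[of 0 "\<lambda>us vs. 0" xs] by simp

lemma move_add: "move x (\<lambda>us vs. f us vs + g us vs) us vs = move x f us vs + move x g us vs"
  by (induction us arbitrary: f g) auto

lemma move_uminus: "move x (\<lambda>us vs. - f us vs) us vs = - move x f us vs"
  by (induction us arbitrary: f) auto

lemma move_sign:
  "move x (\<lambda>us vs. (-1) ^ length us *s f us vs) us vs = - ((-1) ^ length us *s move x f us vs)"
proof (induction us arbitrary: f)
  case (Cons z us)
  show ?case
    by (simp add: move_uminus Cons.IH scale_right_diff_distrib)
qed auto

lemma move_Cons2:
  assumes "bialt f"
  shows "move x f us (y # vs) = - move x (\<lambda>us vs. f us (y # vs)) us vs"
  using assms
proof (induction us arbitrary: f)
  case (Cons z us)
  have "f us (z \<triangleright> x # y # vs) = - f us (y # z \<triangleright> x # vs)"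
    using alt_swap_hd[OF bialt_mlin(2)[OF Cons.prems] bialt_alt(2)[OF Cons.prems]] .
  then show ?case
    using Cons.IH[OF bialt_Cons1[OF Cons.prems]] by simp
qed auto

lemma ce_Cons2: "ce f us (x # vs) = ce (\<lambda>us vs. f us (x # vs)) us vs - move x f us vs"
  by (induction us arbitrary: f) (auto simp: lie_Cons2)

text \<open>Cartan's formula for \<open>ins\<close>: by \<open>ce_sign\<close>, the signed insertion
  into the second block anticommutes with \<open>ce\<close> up to \<open>move\<close>, so it
  combines with the insertion into the first block.\<close>

lemma ins_ce:
  "ins x (ce f) us vs = lie x f us vs - ce (ins x f) us vs - (-1) ^ length us *s move x f us vs"
  by (simp add: ins_eq ce_Cons2 ce_add ce_sign[of "\<lambda>us vs. f us (x # vs)"] algebra_simps)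

text \<open>
  The two summands of \<open>sweep\<close> cancel under \<open>shuf\<close>: both amount to choosing an argument \<open>y\<close>, replacing
  it by \<open>y \<triangleright> x\<close>, placing it in the second block and shuffling the rest.
\<close>

definition sweep :: "'a \<Rightarrow> ('a list \<Rightarrow> 'a list \<Rightarrow> 'a) \<Rightarrow> 'a list \<Rightarrow> 'a list \<Rightarrow> 'a" where
  "sweep x f us vs = (-1) ^ length us *s move x f us vs + der (\<lambda>y. y \<triangleright> x) vs (f us)"

text \<open>The term with \<open>y \<triangleright> x\<close> at the head of the second block arises
  twice, from \<open>move\<close> with \<open>y\<close> in the first block and from
  \<open>der\<close> with \<open>y\<close> in the second, with opposite signs. The other terms form
  the right-hand side.\<close>

lemma ins_sweep:
  assumes "bialt f"
  shows "ins y (sweep x f) = sweep x (ins y f)"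
proof (intro ext)
  fix us vs
  show "ins y (sweep x f) us vs = sweep x (ins y f) us vs"
    using move_Cons2[OF assms, of x us y vs]
    by (simp add: ins_eq sweep_def move_add move_sign[of x "\<lambda>us vs. f us (y # vs)"] der_add der_scale
        algebra_simps)
qed

text \<open>After all insertions \<open>sweep\<close> is evaluated at two empty blocks, where both
  of its summands are empty.\<close>

lemma shuf_sweep:
  assumes "bialt f"
  shows "shuf (sweep x f) xs = 0"
  using assms by (induction xs arbitrary: f) (auto simp: ins_sweep sweep_def)

text \<open>
  Unlike \<open>lie\<close>, this acts by the bracket on both blocks, hence commutes with shuffling. The
  difference is made up by \<open>sweep\<close>, since \<open>x \<triangleright> y = [x, y] + y \<triangleright> x\<close>.
\<close>

definition adj :: "'a \<Rightarrow> ('a list \<Rightarrow> 'a list \<Rightarrow> 'a) \<Rightarrow> 'a list \<Rightarrow> 'a list \<Rightarrow> 'a" where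
  "adj x f us vs = x \<triangleright> f us vs - der (br x) us (\<lambda>us. f us vs) - der (br x) vs (f us)"

lemma ins_adj: "ins y (adj x f) = (\<lambda>us vs. adj x (ins y f) us vs - ins (br x y) f us vs)"
proof (intro ext)
  fix us vs
  show "ins y (adj x f) us vs = adj x (ins y f) us vs - ins (br x y) f us vs"
    using der_length_scale[of "br x" us "\<lambda>n. (-1) ^ n" "\<lambda>us. f us (y # vs)"]
    by (simp add: ins_eq adj_def der_add der_scale pl_simps algebra_simps)
qed

lemma shuf_adj: "shuf (adj x f) xs = x \<triangleright> shuf f xs - der (br x) xs (shuf f)"
  by (induction xs arbitrary: f) (auto simp: adj_def[of _ _ "[]" "[]"] ins_adj shuf_diff)

lemma lie_eq_adj:
  assumes "bialt f"
  shows "lie x f us vs = adj x f us vs - sweep x f us vs + (-1) ^ length us *s move x f us vs"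
proof -
  have "(\<triangleright>) x = (\<lambda>y. br x y + y \<triangleright> x)"
    by (auto simp: br_def)
  then show ?thesis
    using der_map_add[OF bialt_mlin(2)[OF assms], of "br x" "\<lambda>y. y \<triangleright> x" vs us]
    by (simp add: lie_def adj_def sweep_def)
qed

text \<open>The identity \<open>\<Phi>d = d\<Phi>\<close>; on the right \<open>d\<close> has
  coefficients in the algebra itself, hence the empty second block. The \<open>move\<close> terms of
  \<open>ins_ce\<close> and \<open>lie_eq_adj\<close> cancel, \<open>sweep\<close> dies under
  \<open>shuf\<close>, and \<open>adj\<close> passes through it.\<close>

lemma shuf_ce:
  assumes "bialt f"
  shows "shuf (ce f) xs = ce (\<lambda>us vs. shuf f us) xs []"
  using assms
proof (induction xs arbitrary: f)
  case (Cons x xs)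
  have "ins x (ce f) = (\<lambda>us vs. adj x f us vs - sweep x f us vs - ce (ins x f) us vs)"
    by (simp add: fun_eq_iff ins_ce lie_eq_adj[OF Cons.prems])
  then show ?case
    using Cons.IH[OF bialt_ins[OF Cons.prems]]
    by (simp add: shuf_diff shuf_adj shuf_sweep[OF Cons.prems] lie_def)
qed auto

section \<open>Supports by argument length, and alternation of shuffle sums\<close>

lemma der_vanish: "(\<And>zs. length zs = length xs \<Longrightarrow> g zs = 0) \<Longrightarrow> der t xs g = 0"
  by (induction xs arbitrary: g) auto

lemma lie_vanish:
  "(\<And>us' vs'. length us' = length us \<Longrightarrow> length vs' = length vs \<Longrightarrow> f us' vs' = 0) \<Longrightarrow> lie x f us vs = 0"
  by (simp add: lie_def der_vanish pl_simps)

lemma ce_vanish: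
  "(\<And>us' vs'. Suc (length us') = length us \<Longrightarrow> length vs' = length vs \<Longrightarrow> f us' vs' = 0) \<Longrightarrow> ce f us vs = 0"
  by (induction us arbitrary: f) (auto intro: lie_vanish)

lemma shuf_cong:
  assumes "\<And>us vs. length us + length vs = length xs \<Longrightarrow> f us vs = g us vs"
  shows "shuf f xs = shuf g xs"
  using assms
proof (induction xs arbitrary: f g)
  case (Cons x xs)
  have "shuf (ins x f) xs = shuf (ins x g) xs"
    by (rule Cons.IH) (simp add: ins_eq Cons.prems)
  then show ?case
    by simp
qed auto

lemma shuf_vanish:
  "(\<And>us vs. length us + length vs = length xs \<Longrightarrow> f us vs = 0) \<Longrightarrow> shuf f xs = 0"
  using shuf_cong[of xs f "\<lambda>us vs. 0"] by simp

lemma lin_shuf_param: "(\<And>us vs. lin (\<lambda>v. F v us vs)) \<Longrightarrow> lin (\<lambda>v. shuf (F v) xs)"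
proof (induction xs arbitrary: F)
  case (Cons x xs)
  have "lin (\<lambda>v. ins x (F v) us vs)" for us vs
    unfolding ins_eq by (intro lin_add lin_scale Cons.prems)
  then show ?case
    using Cons.IH by simp
qed auto

lemma mlin_shuf:
  assumes "bialt f"
  shows "mlin (shuf f)"
proof -
  have "lin (\<lambda>v. shuf f (us @ v # vs))" for us vs
    using assms
  proof (induction us arbitrary: f)
    case Nil
    have "lin (\<lambda>v. shuf (ins v f) vs)"
      by (rule lin_shuf_param) (auto simp: ins_eq intro!: lin_add lin_scale bialtD_lin[OF Nil])
    then show ?case
      by simp
  next
    case (Cons u us)
    then show ?case
      using Cons.IH[OF bialt_ins[OF Cons.prems]] by simp
  qed
  then show ?thesis
    by (simp add: mlin_def)
qed

text \<open>Inserting \<open>v\<close> twice gives zero: the two terms with one \<open>v\<close> in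
  each block carry opposite signs, and the others have two equal neighbours.\<close>

lemma alt_shuf:
  assumes "bialt f"
  shows "alt (shuf f)"
proof -
  have "shuf f (us @ v # v # vs) = 0" for us v vs
    using assms
  proof (induction us arbitrary: f)
    case Nil
    have "ins v (ins v f) = (\<lambda>us vs. 0)"
      by (simp add: fun_eq_iff ins_eq bialtD_alt[OF Nil] scale_right_distrib)
    then show ?case
      by simp
  next
    case (Cons u us)
    then show ?case
      using Cons.IH[OF bialt_ins[OF Cons.prems]] by simp
  qed
  then show ?thesis
    by (simp add: alt_def)
qed

lemma shuf_Nil2: "shuf (\<lambda>us vs. if vs = [] then h us else 0) xs = h xs"
proof (induction xs arbitrary: h)
  case (Cons x xs)
  have "ins x (\<lambda>us vs. if vs = [] then h us else 0) = (\<lambda>us vs. if vs = [] then h (x # us) else 0)"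
    by (auto simp: ins_eq fun_eq_iff)
  then show ?case
    using Cons.IH by simp
qed auto

section \<open>The square of the differential\<close>

definition act :: "('a list \<Rightarrow> 'a) \<Rightarrow> 'a list \<Rightarrow> 'a list \<Rightarrow> 'a" where
  "act g us vs = (if length vs = 1 then g us \<triangleright> vs ! 0 else 0)"

text \<open>The alternating sum over the entries of \<open>us\<close> in which \<open>g\<close>,
  evaluated without the entry, acts on that entry.\<close>

fun self_act :: "('a list \<Rightarrow> 'a) \<Rightarrow> 'a list \<Rightarrow> 'a" where
  "self_act g [] = 0"
| "self_act g (x # us) = g us \<triangleright> x - self_act (\<lambda>us. g (x # us)) us"

lemma act_Cons: "act g (x # us) = act (\<lambda>us. g (x # us)) us"
  by (simp add: act_def fun_eq_iff)

text \<open>By the pre-Lie identity, the actions of \<open>x\<close> on the value and on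
  \<open>y\<close> combine to \<open>br x (g us) \<triangleright> y\<close>. The half
  \<open>x \<triangleright> g us\<close> of this bracket belongs to the differential of
  \<open>g\<close>; the other half accumulates in \<open>self_act\<close>.\<close>

lemma ce_act: "ce (act g) us [y] = (ce (\<lambda>us vs. g us) us [] - self_act g us) \<triangleright> y"
proof (induction us arbitrary: g)
  case (Cons x us)
  have "lie x (act g) us [y] = (lie x (\<lambda>us vs. g us) us [] - g us \<triangleright> x) \<triangleright> y"
    using br_pl[of x "g us" y]
    by (simp add: lie_def act_def der_pl_left pl_simps br_def)
  then show ?case
    by (simp add: Cons.IH pl_simps act_Cons[abs_def])
qed (auto simp: pl_simps)

text \<open>Once \<open>x\<close> is put into the second block, all other entries must go to the
  first one, and \<open>x\<close> passes all of them.\<close>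

lemma shuf_single:
  assumes "\<And>us vs. length vs \<noteq> 1 \<Longrightarrow> f us vs = 0"
  shows "shuf f (x # xs) = shuf (\<lambda>us. f (x # us)) xs + (-1) ^ length xs *s f xs [x]"
proof -
  have *: "(\<lambda>us vs. (-1) ^ length us *s f us (x # vs))
      = (\<lambda>us vs. if vs = [] then (-1) ^ length us *s f us [x] else 0)"
    using assms by (auto simp: fun_eq_iff)
  have "shuf (\<lambda>us vs. (-1) ^ length us *s f us (x # vs)) xs = (-1) ^ length xs *s f xs [x]"
    unfolding * by (rule shuf_Nil2)
  then show ?thesis
    by (simp add: ins_eq shuf_add)
qed

lemma shuf_act: "shuf (act g) us = - ((-1) ^ length us *s self_act g us)"
proof (induction us arbitrary: g)
  case (Cons x us)
  have "shuf (act g) (x # us) = shuf (act (\<lambda>us. g (x # us))) us + (-1) ^ length us *s act g us [x]"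
    unfolding act_Cons[symmetric] by (rule shuf_single) (simp add: act_def)
  then show ?case
    by (simp add: Cons.IH algebra_simps) (simp add: act_def)
qed (auto simp: act_def)

text \<open>
  The sign is that of \<open>(-1) ^ (length us - 1)\<close>, written so that no subtraction is truncated.
\<close>

definition high :: "('a list \<Rightarrow> 'a list \<Rightarrow> 'a) \<Rightarrow> 'a list \<Rightarrow> 'a list \<Rightarrow> 'a" where
  "high f us vs = - ((-1) ^ length us *s act (shuf f) us vs)"

lemma high_add: "high (\<lambda>us vs. f us vs + g us vs) us vs = high f us vs + high g us vs"
  by (simp add: high_def act_def shuf_add pl_simps algebra_simps)

lemma high_zero [simp]: "high (\<lambda>us vs. 0) us vs = 0"
  by (simp add: high_def act_def pl_simps)

lemma high_sum: "high (\<lambda>us vs. \<Sum>i\<in>I. f i us vs) us vs = (\<Sum>i\<in>I. high (f i) us vs)"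
  by (induction I rule: infinite_finite_induct) (auto simp: high_add)

lemma bialt_act:
  assumes "mlin g" "alt g"
  shows "bialt (act g)"
proof -
  have "lin (\<lambda>v. act g (us @ v # us') vs)" for us us' vs
    using lin_comp[OF linear_left mlinD[OF assms(1)]]
    by (cases "length vs = 1") (auto simp: act_def)
  moreover have "lin (\<lambda>v. act g us (vs @ v # vs'))" for us vs vs'
    by (cases vs; cases vs') (auto simp: act_def linear_right)
  ultimately show ?thesis
    using altD[OF assms(2)] by (auto simp: bialt_def mlin_def alt_def act_def pl_simps)
qed

lemma bialt_high [intro]:
  assumes "bialt f"
  shows "bialt (high f)"
proof -
  have "high f = (\<lambda>us vs. - ((-1) ^ length us) *s act (shuf f) us vs)"
    by (simp add: high_def fun_eq_iff)
  with bialt_act[OF mlin_shuf[OF assms] alt_shuf[OF assms]] show ?thesis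
    using bialt_length_scale[of "act (shuf f)" "\<lambda>n. - ((-1) ^ n)"] by simp
qed

lemma shuf_high: "shuf (high f) us = - self_act (shuf f) us"
proof -
  \<comment> \<open>Only \<open>length vs' = 1\<close> contributes, so the sign depends on the total
    length alone.\<close>
  have "high f us' vs' = (-1) ^ length us *s act (shuf f) us' vs'"
    if "length us' + length vs' = length us" for us' vs'
    using that by (auto simp: high_def act_def simp flip: that)
  then have "shuf (high f) us = shuf (\<lambda>us' vs'. (-1) ^ length us *s act (shuf f) us' vs') us"
    by (rule shuf_cong)
  then show ?thesis
    by (simp add: shuf_scale shuf_act)
qed

text \<open>For \<open>vs = [y]\<close>, the \<open>self_act\<close> term of
  \<open>ce (high f)\<close> is cancelled by \<open>high (high f)\<close>, and the rest by
  \<open>high (ce f)\<close> through \<open>shuf_ce\<close>. For other lengths of \<open>vs\<close>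
  each summand vanishes.\<close>

lemma ce_high:
  assumes "bialt f"
  shows "ce (high f) us vs + high (ce f) us vs + high (high f) us vs = 0"
proof (cases "length vs = 1")
  case True
  then obtain y where vs: "vs = [y]"
    by (auto simp: length_Suc_conv)
  have "ce (high f) us vs = ce (\<lambda>us vs. 0 - (-1) ^ length us *s act (shuf f) us vs) us vs"
    by (simp add: high_def[abs_def])
  also have "\<dots> = (-1) ^ length us *s ce (act (shuf f)) us vs"
    unfolding ce_diff ce_sign by simp
  finally show ?thesis
    using shuf_ce[OF assms, of us]
    by (simp add: vs ce_act high_def[of "ce f"] high_def[of "high f"] shuf_high)
      (simp add: act_def shuf_high pl_simps algebra_simps)
next
  case False
  then show ?thesis
    by (auto simp: high_def act_def intro!: ce_vanish)
qed

lemma cochain_square: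
  assumes "bialt f"
  defines "g \<equiv> \<lambda>us vs. ce f us vs + high f us vs"
  shows "ce g us vs + high g us vs = 0"
  using ce_high[OF assms(1), of us vs] by (simp add: g_def ce_add high_add ce_ce[OF assms(1)] algebra_simps)

section \<open>The explicit formulas\<close>

text \<open>Adjacent swaps move the first \<open>v\<close> to the right until it meets the
  second.\<close>

lemma alt_far:
  assumes "mlin g" "alt g"
  shows "g (us @ v # ws @ v # zs) = 0"
proof (induction ws arbitrary: us)
  case Nil
  then show ?case
    using altD[OF assms(2)] by simp
next
  case (Cons w ws)
  have "g (us @ v # w # ws @ v # zs) = - g (us @ w # v # ws @ v # zs)"
    by (rule alt_swap[OF assms])
  also have "g (us @ w # v # ws @ v # zs) = 0"
    using Cons.IH[of "us @ [w]"] by simp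
  finally show ?case
    by simp
qed

lemma alt_nth:
  assumes "mlin g" "alt g" "i < j" "j < length xs" "xs ! i = xs ! j"
  shows "g xs = 0"
proof -
  define k where "k = j - Suc i"
  have "xs = take i xs @ xs ! i # drop (Suc i) xs"
    by (rule id_take_nth_drop) (use assms in simp)
  also have "drop (Suc i) xs = take k (drop (Suc i) xs) @ drop (Suc i) xs ! k # drop (Suc k) (drop (Suc i) xs)"
    using assms by (intro id_take_nth_drop) (auto simp: k_def)
  also have "drop (Suc i) xs ! k = xs ! i"
    using assms by (simp add: k_def)
  finally show ?thesis
    using alt_far[OF assms(1,2)] by metis
qed

text \<open>At wrong lengths \<open>f\<close> is zero, so linearity and alternation hold there
  trivially; this turns the conditions at fixed lengths into the length-free \<open>bialt\<close>
  plus a support condition.\<close>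

lemma wedge_hom_iff:
  "f \<in> wedge_hom p q \<longleftrightarrow>
     bialt f \<and> (\<forall>us vs. length us \<noteq> p \<or> length vs \<noteq> q \<longrightarrow> f us vs = 0)" (is "?W \<longleftrightarrow> ?B")
proof
  assume W: ?W
  then have z: "f us vs = 0" if "length us \<noteq> p \<or> length vs \<noteq> q" for us vs
    using that by (simp add: wedge_hom_def)
  have upd1: "lin (\<lambda>v. f (us[i := v]) vs)"
    if "length us = p \<and> length vs = q" "i < p" for us vs i
    using W that by (simp add: wedge_hom_def)
  have upd2: "lin (\<lambda>v. f us (vs[i := v]))"
    if "length us = p \<and> length vs = q" "i < q" for us vs i
    using W that by (simp add: wedge_hom_def)
  have "lin (\<lambda>v. f (us @ v # us') vs)" for us us' vs
  \<comment> \<open>The \<open>0\<close> is a placeholder that the list update replaces by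
    \<open>v\<close>.\<close>
  proof (cases "length (us @ 0 # us') = p \<and> length vs = q")
    case True
    then have "lin (\<lambda>v. f ((us @ 0 # us')[length us := v]) vs)"
      by (rule upd1) (use True in auto)
    then show ?thesis
      by (simp add: list_update_append)
  next
    case False
    then have "(\<lambda>v. f (us @ v # us') vs) = (\<lambda>v. 0)"
      using z by auto
    then show ?thesis
      by auto
  qed
  moreover have "lin (\<lambda>v. f us (vs @ v # vs'))" for us vs vs'
  proof (cases "length us = p \<and> length (vs @ 0 # vs') = q")
    case True
    then have "lin (\<lambda>v. f us ((vs @ 0 # vs')[length vs := v]))"
      by (rule upd2) (use True in auto)
    then show ?thesis
      by (simp add: list_update_append)
  next
    case False
    then have "(\<lambda>v. f us (vs @ v # vs')) = (\<lambda>v. 0)"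
      using z by auto
    then show ?thesis
      by auto
  qed
  moreover have "f (us @ v # v # us') vs = 0" for us us' v vs
  proof (cases "length (us @ v # v # us') = p \<and> length vs = q")
    case True
    moreover have "\<forall>i j. i < j \<longrightarrow> j < p \<longrightarrow> xs ! i = xs ! j \<longrightarrow> f xs vs = 0"
      if "length xs = p" "length vs = q" for xs
      using W that unfolding wedge_hom_def by blast
    from this[of "us @ v # v # us'", rule_format, of "length us" "Suc (length us)"]
    show ?thesis
      using True by (simp add: nth_append)
  qed (use z in blast)
  moreover have "f us (vs @ v # v # vs') = 0" for us v vs vs'
  proof (cases "length us = p \<and> length (vs @ v # v # vs') = q")
    case True
    moreover have "\<forall>i j. i < j \<longrightarrow> j < q \<longrightarrow> ys ! i = ys ! j \<longrightarrow> f us ys = 0"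
      if "length us = p" "length ys = q" for ys
      using W that unfolding wedge_hom_def by blast
    from this[of "vs @ v # v # vs'", rule_format, of "length vs" "Suc (length vs)"]
    show ?thesis
      using True by (simp add: nth_append)
  qed (use z in blast)
  ultimately show ?B
    using z by (auto simp: bialt_def mlin_def alt_def)
next
  assume B: ?B
  then have f: "bialt f"
    by blast
  have "lin (\<lambda>v. f (xs[i := v]) ys)" if "i < length xs" for xs i ys
    using bialtD_lin(1)[OF f, of "take i xs"] that by (simp add: upd_conv_take_nth_drop)
  moreover have "lin (\<lambda>v. f xs (ys[i := v]))" if "i < length ys" for xs i ys
    using bialtD_lin(2)[OF f, of _ "take i ys"] that by (simp add: upd_conv_take_nth_drop)
  moreover have "f xs ys = 0" if "i < j" "j < length xs" "xs ! i = xs ! j" for i j xs ys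
    using alt_nth[OF bialt_mlin(1)[OF f] bialt_alt(1)[OF f] that] .
  moreover have "f xs ys = 0" if "i < j" "j < length ys" "ys ! i = ys ! j" for i j xs ys
    using alt_nth[OF bialt_mlin(2)[OF f] bialt_alt(2)[OF f] that] .
  ultimately show ?W
    using B unfolding wedge_hom_def mem_Collect_eq by (intro conjI allI impI) simp_all
qed

section \<open>The recursions as explicit alternating sums\<close>

lemma nths_omit [simp]:
  "nths (x # xs) (- {0}) = xs"
  "nths (x # xs) (- {Suc i}) = x # nths xs (- {i})"
  "nths (x # xs) (- {0, Suc j}) = nths xs (- {j})"
  "nths (x # xs) (- {Suc i, Suc j}) = x # nths xs (- {i, j})"
  by (auto simp: nths_Cons nths_all intro!: arg_cong[of _ _ "nths xs"])

text \<open>Bringing the replaced entry from position \<open>j\<close> to the front passes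
  \<open>j\<close> entries.\<close>

lemma der_eq_sum:
  assumes "mlin g" "alt g"
  shows "der t xs g = (\<Sum>j<length xs. (-1) ^ j *s g (t (xs ! j) # nths xs (- {j})))"
  using assms
proof (induction xs arbitrary: g)
  case (Cons x xs)
  have "g (x # t y # zs) = - g (t y # x # zs)" for y zs
    by (rule alt_swap_hd[OF Cons.prems])
  then show ?case
    by (simp add: Cons.IH[OF mlin_Cons[OF Cons.prems(1)] alt_Cons[OF Cons.prems(2)]]
        sum.lessThan_Suc_shift del: sum.lessThan_Suc)
qed auto

text \<open>For \<open>x # xs\<close>, the Lie derivative along \<open>x\<close> supplies the terms
  with \<open>i = 0\<close> and the recursive call the others. Swapping \<open>x\<close> with the
  bracket at the head corrects the sign in the middle sum, where both indices are shifted.\<close>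

lemma ce_eq_sum:
  assumes "bialt f"
  shows "ce f xs ys =
      (\<Sum>i<length xs. (-1) ^ i *s (xs ! i \<triangleright> f (nths xs (- {i})) ys))
      + (\<Sum>j<length xs. \<Sum>i<j. (-1) ^ (i + j) *s f (br (xs ! i) (xs ! j) # nths xs (- {i, j})) ys)
      - (\<Sum>i<length xs. \<Sum>j<length ys. (-1) ^ (i + j) *s
           f (nths xs (- {i})) ((xs ! i \<triangleright> ys ! j) # nths ys (- {j})))"
  using assms
proof (induction xs arbitrary: f)
  case (Cons x xs)
  have swap: "f (x # br y z # zs) ys = - f (br y z # x # zs) ys" for y z zs
    by (rule alt_swap_hd[OF bialt_mlin(1)[OF Cons.prems] bialt_alt(1)[OF Cons.prems]])
  have "lie x f xs ys = x \<triangleright> f xs ys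
      - (\<Sum>j<length xs. (-1) ^ j *s f (br x (xs ! j) # nths xs (- {j})) ys)
      - (\<Sum>j<length ys. (-1) ^ j *s f xs ((x \<triangleright> ys ! j) # nths ys (- {j})))"
    using Cons.prems by (simp add: lie_def bialt_def der_eq_sum)
  then show ?case
    by (simp add: Cons.IH[OF bialt_Cons1[OF Cons.prems]] swap sum.lessThan_Suc_shift sum.distrib
        sum_negf sum_subtractf del: sum.lessThan_Suc)
qed auto

lemma PL_diff_low_eq:
  assumes "f \<in> wedge_hom k (n - k)"
  shows "PL_diff_low n k f = ce f"
proof (intro ext)
  fix xs ys
  have f: "bialt f" "length us \<noteq> k \<or> length vs \<noteq> n - k \<Longrightarrow> f us vs = 0" for us vs
    using assms by (auto simp: wedge_hom_iff)
  show "PL_diff_low n k f xs ys = ce f xs ys"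
  proof (cases "length xs = k + 1 \<and> length ys = n - k")
    case True
    then show ?thesis
      by (simp add: PL_diff_low_def ce_eq_sum[OF f(1)] br_def)
  next
    case False
    then have "ce f xs ys = 0"
      by (intro ce_vanish f(2)) auto
    then show ?thesis
      by (simp only: PL_diff_low_def False if_False)
  qed
qed

text \<open>Moving entry \<open>i\<close> to the end has sign
  \<open>(-1) ^ (length xs - 1 - i)\<close>, which the prefactor turns into \<open>(-1) ^ i\<close>.
  This identifies the second sum of \<open>PL_diff_top\<close> with \<open>high\<close>.\<close>

lemma shuf_eq_sum:
  assumes "\<And>us vs. length vs \<noteq> 1 \<Longrightarrow> f us vs = 0"
  shows "- ((-1) ^ length xs *s shuf f xs) = (\<Sum>i<length xs. (-1) ^ i *s f (nths xs (- {i})) [xs ! i])"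
  using assms
proof (induction xs arbitrary: f)
  case (Cons x xs)
  show ?case
    using Cons.IH[of "\<lambda>us. f (x # us)"] Cons.prems
    by (simp add: shuf_single sum.lessThan_Suc_shift sum_negf scale_right_distrib
        del: sum.lessThan_Suc shuf.simps)
qed auto

lemma PL_diff_top_eq:
  assumes "f \<in> wedge_hom m 1"
  shows "PL_diff_top (Suc m) f = (\<lambda>us vs. ce f us vs + high f us vs)"
proof (intro ext)
  fix xs ys
  have f: "bialt f" "length us \<noteq> m \<or> length vs \<noteq> 1 \<Longrightarrow> f us vs = 0" for us vs
    using assms by (auto simp: wedge_hom_iff)
  show "PL_diff_top (Suc m) f xs ys = ce f xs ys + high f xs ys"
  proof (cases "length xs = Suc m \<and> length ys = 1")
    case True
    then obtain y where ys: "ys = [y]"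
      by (auto simp: length_Suc_conv)
    have *: "(\<Sum>i<Suc m. (-1) ^ i *s (f (nths xs (- {i})) [xs ! i] \<triangleright> y)) = high f xs ys"
    proof -
      have "(\<Sum>i<Suc m. (-1) ^ i *s (f (nths xs (- {i})) [xs ! i] \<triangleright> y))
          = (\<Sum>i<length xs. (-1) ^ i *s f (nths xs (- {i})) [xs ! i]) \<triangleright> y"
        using True by (simp add: pl_sum_left pl_simps del: sum.lessThan_Suc)
      also have "\<dots> = high f xs ys"
        using shuf_eq_sum[of f xs, symmetric] f(2) by (simp add: high_def act_def ys pl_simps)
      finally show ?thesis .
    qed
    \<comment> \<open>The instance of \<open>sum.lessThan_Suc\<close> at \<open>0\<close> collapses
      only the sum over the single entry of \<open>ys\<close>.\<close>
    show ?thesis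
      using True *
      by (simp add: PL_diff_top_def ce_eq_sum[OF f(1)] br_def ys algebra_simps
          sum.lessThan_Suc[where n = 0] del: sum.lessThan_Suc)
  next
    case False
    then have "ce f xs ys = 0"
      by (intro ce_vanish f(2)) auto
    moreover have "high f xs ys = 0"
    proof (cases "length ys = 1")
      case True
      then have "shuf f xs = 0"
        using False by (intro shuf_vanish f(2)) auto
      then show ?thesis
        by (simp add: high_def act_def pl_simps)
    qed (simp add: high_def act_def)
    ultimately show ?thesis
      by (simp only: PL_diff_top_def False if_False add_0_left)
  qed
qed

section \<open>Shuffle permutations, split by the block that receives the first argument\<close>

lemma shuffle_perms_0_0: "shuffle_perms 0 0 = {id}"
  by (auto simp: shuffle_perms_def strict_mono_on_def permutes_id)

lemma shuffle_perms_hd1: "{\<sigma> \<in> shuffle_perms (Suc k) m. \<sigma> 0 = 0} = shift ` shuffle_perms k m"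
proof (intro equalityI subsetI)
  fix \<sigma>
  assume "\<sigma> \<in> {\<sigma> \<in> shuffle_perms (Suc k) m. \<sigma> 0 = 0}"
  then have \<sigma>: "\<sigma> permutes {..<Suc (k + m)}" "strict_mono_on {..<Suc k} \<sigma>"
      "strict_mono_on {Suc k..<Suc (k + m)} \<sigma>" "\<sigma> 0 = 0"
    by (auto simp: shuffle_perms_def)
  obtain \<tau> where \<tau>: "\<tau> permutes {..<k + m}" "\<sigma> = shift \<tau>"
    using shift_surj[OF \<sigma>(1,4)] .
  have "\<tau> i < \<tau> j" if "i < j" "j < k" for i j
    using strict_mono_onD[OF \<sigma>(2), of "Suc i" "Suc j"] that \<tau>(2) by simp
  moreover have "\<tau> i < \<tau> j" if "i < j" "k \<le> i" "j < k + m" for i j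
    using strict_mono_onD[OF \<sigma>(3), of "Suc i" "Suc j"] that \<tau>(2) by simp
  ultimately show "\<sigma> \<in> shift ` shuffle_perms k m"
    using \<tau> by (auto simp: shuffle_perms_def strict_mono_on_def)
next
  fix \<sigma>
  assume "\<sigma> \<in> shift ` shuffle_perms k m"
  then obtain \<tau> where \<tau>: "\<sigma> = shift \<tau>" "\<tau> permutes {..<k + m}"
      "strict_mono_on {..<k} \<tau>" "strict_mono_on {k..<k + m} \<tau>"
    by (auto simp: shuffle_perms_def)
  have "\<sigma> i < \<sigma> j" if "i < j" "j < Suc k" for i j
    using strict_mono_onD[OF \<tau>(3), of "i - 1" "j - 1"] that \<tau>(1) by (cases i; cases j) auto
  moreover have "\<sigma> i < \<sigma> j" if "i < j" "Suc k \<le> i" "j < Suc (k + m)" for i j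
    using strict_mono_onD[OF \<tau>(4), of "i - 1" "j - 1"] that \<tau>(1) by (cases i; cases j) auto
  ultimately show "\<sigma> \<in> {\<sigma> \<in> shuffle_perms (Suc k) m. \<sigma> 0 = 0}"
    using shift_permutes[OF \<tau>(2)] \<tau>(1) by (auto simp: shuffle_perms_def strict_mono_on_def)
qed

text \<open>Precomposing with the inverse of \<open>cyc k\<close> turns a shuffle with
  \<open>\<sigma> k = 0\<close> into a permutation fixing \<open>0\<close>, to which
  \<open>shift_surj\<close> applies.\<close>

lemma shuffle_perms_hd2:
  "{\<sigma> \<in> shuffle_perms k (Suc m). \<sigma> k = 0} = (\<lambda>\<sigma>. shift \<sigma> \<circ> cyc k) ` shuffle_perms k m"
proof (intro equalityI subsetI)
  fix \<sigma>
  assume "\<sigma> \<in> {\<sigma> \<in> shuffle_perms k (Suc m). \<sigma> k = 0}"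
  then have \<sigma>: "\<sigma> permutes {..<Suc (k + m)}" "strict_mono_on {..<k} \<sigma>"
      "strict_mono_on {k..<Suc (k + m)} \<sigma>" "\<sigma> k = 0"
    by (auto simp: shuffle_perms_def)
  have c: "cyc k permutes {..<Suc (k + m)}"
    by (rule permutes_subset[OF cyc_permutes]) auto
  have "inv (cyc k) 0 = k"
    using permutes_inv_eq[OF c] by (simp add: cyc_apply)
  then have "(\<sigma> \<circ> inv (cyc k)) 0 = 0"
    using \<sigma>(4) by simp
  then obtain \<tau> where \<tau>: "\<tau> permutes {..<k + m}" "\<sigma> \<circ> inv (cyc k) = shift \<tau>"
    using shift_surj[OF permutes_compose[OF permutes_inv[OF c] \<sigma>(1)]] by blast
  have eq: "\<sigma> = shift \<tau> \<circ> cyc k"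
    unfolding \<tau>(2)[symmetric] comp_assoc using permutes_inv_o(2)[OF c] by simp
  have "\<tau> i < \<tau> j" if "i < j" "j < k" for i j
    using strict_mono_onD[OF \<sigma>(2), of i j] that eq by (simp add: cyc_apply)
  moreover have "\<tau> i < \<tau> j" if "i < j" "k \<le> i" "j < k + m" for i j
    using strict_mono_onD[OF \<sigma>(3), of "Suc i" "Suc j"] that eq by (simp add: cyc_apply)
  ultimately show "\<sigma> \<in> (\<lambda>\<sigma>. shift \<sigma> \<circ> cyc k) ` shuffle_perms k m"
    using \<tau>(1) eq by (auto simp: shuffle_perms_def strict_mono_on_def)
next
  fix \<sigma>
  assume "\<sigma> \<in> (\<lambda>\<sigma>. shift \<sigma> \<circ> cyc k) ` shuffle_perms k m"
  then obtain \<tau> where \<tau>: "\<sigma> = shift \<tau> \<circ> cyc k" "\<tau> permutes {..<k + m}"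
      "strict_mono_on {..<k} \<tau>" "strict_mono_on {k..<k + m} \<tau>"
    by (auto simp: shuffle_perms_def)
  have "cyc k permutes {..<Suc (k + m)}"
    by (rule permutes_subset[OF cyc_permutes]) auto
  then have "\<sigma> permutes {..<Suc (k + m)}"
    unfolding \<tau>(1) using shift_permutes[OF \<tau>(2)] by (rule permutes_compose)
  moreover have "\<sigma> i < \<sigma> j" if "i < j" "j < k" for i j
    using strict_mono_onD[OF \<tau>(3), of i j] that \<tau>(1) by (simp add: cyc_apply)
  moreover have "\<sigma> i < \<sigma> j" if "i < j" "k \<le> i" "j < Suc (k + m)" for i j
    \<comment> \<open>For \<open>i = k\<close> the claim comes instead from
      \<open>\<sigma> k = 0\<close>, which lies below every successor.\<close>
    using strict_mono_onD[OF \<tau>(4), of "i - 1" "j - 1"] that \<tau>(1)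
    by (cases i; cases j) (auto simp: cyc_apply)
  moreover have "\<sigma> k = 0"
    by (simp add: \<tau>(1) cyc_apply)
  ultimately show "\<sigma> \<in> {\<sigma> \<in> shuffle_perms k (Suc m). \<sigma> k = 0}"
    by (auto simp: shuffle_perms_def strict_mono_on_def)
qed

lemma finite_shuffle_perms [simp]: "finite (shuffle_perms k m)"
  by (rule finite_subset[OF _ finite_permutations[of "{..<k + m}"]]) (auto simp: shuffle_perms_def)

text \<open>The value \<open>0\<close> is the least one, and monotonicity on each block forces it to
  the first position of its block.\<close>

lemma shuffle_perms_split:
  assumes "\<sigma> \<in> shuffle_perms k m" "k + m > 0"
  shows "k > 0 \<and> \<sigma> 0 = 0 \<or> m > 0 \<and> \<sigma> k = 0"
proof -
  have \<sigma>: "\<sigma> permutes {..<k + m}" "strict_mono_on {..<k} \<sigma>" "strict_mono_on {k..<k + m} \<sigma>"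
    using assms(1) by (auto simp: shuffle_perms_def)
  obtain i where i: "i < k + m" "\<sigma> i = 0"
    using permutes_image[OF \<sigma>(1)] assms(2) by (metis imageE lessThan_iff)
  show ?thesis
  proof (cases "i < k")
    case True
    then have "i = 0"
      using strict_mono_onD[OF \<sigma>(2), of 0 i] i by fastforce
    then show ?thesis
      using i True by simp
  next
    case False
    then have "i = k"
      using strict_mono_onD[OF \<sigma>(3), of k i] i by fastforce
    then show ?thesis
      using i by simp
  qed
qed

definition shuffle_sum :: "nat \<Rightarrow> nat \<Rightarrow> ('a list \<Rightarrow> 'a list \<Rightarrow> 'a) \<Rightarrow> 'a list \<Rightarrow> 'a" where
  "shuffle_sum k m f xs = (\<Sum>\<sigma>\<in>shuffle_perms k m. of_int (sign \<sigma>) *s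
     f (map (\<lambda>i. xs ! \<sigma> i) [0..<k]) (map (\<lambda>i. xs ! \<sigma> i) [k..<k + m]))"

lemma inj_shift: "inj shift"
  by (rule injI) (metis ext nat.inject shift_simps(2))

lemma sum_shuffle_perms_hd1:
  "(\<Sum>\<sigma> | \<sigma> \<in> shuffle_perms (Suc k) m \<and> \<sigma> 0 = 0. of_int (sign \<sigma>) *s
     f (map (\<lambda>i. (x # xs) ! \<sigma> i) [0..<Suc k]) (map (\<lambda>i. (x # xs) ! \<sigma> i) [Suc k..<Suc k + m]))
   = shuffle_sum k m (\<lambda>us. f (x # us)) xs"
proof -
  have "sign (shift \<sigma>) = sign \<sigma>" if "\<sigma> \<in> shuffle_perms k m" for \<sigma>
    using that by (auto simp: shuffle_perms_def intro: sign_shift)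
  moreover have "map (\<lambda>i. (x # xs) ! shift \<sigma> i) [0..<Suc k] = x # map (\<lambda>i. xs ! \<sigma> i) [0..<k]" for \<sigma>
    by (simp add: map_upt_Suc del: upt_Suc)
  moreover have "map (\<lambda>i. (x # xs) ! shift \<sigma> i) [Suc k..<Suc k + m]
      = map (\<lambda>i. xs ! \<sigma> i) [k..<k + m]" for \<sigma>
    by (simp add: map_Suc_upt[symmetric] o_def del: upt_Suc map_Suc_upt)
  ultimately show ?thesis
    unfolding shuffle_perms_hd1 shuffle_sum_def
    by (subst sum.reindex) (auto intro: inj_on_subset[OF inj_shift] simp del: upt_Suc)
qed

text \<open>The factor \<open>(-1) ^ k\<close> is the sign of \<open>cyc k\<close>: the argument
  \<open>x\<close> passes the whole first block.\<close>

lemma sum_shuffle_perms_hd2: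
  "(\<Sum>\<sigma> | \<sigma> \<in> shuffle_perms k (Suc m) \<and> \<sigma> k = 0. of_int (sign \<sigma>) *s
     f (map (\<lambda>i. (x # xs) ! \<sigma> i) [0..<k]) (map (\<lambda>i. (x # xs) ! \<sigma> i) [k..<k + Suc m]))
   = (-1) ^ k *s shuffle_sum k m (\<lambda>us vs. f us (x # vs)) xs"
proof -
  have "sign (shift \<sigma> \<circ> cyc k) = (-1) ^ k * sign \<sigma>" if "\<sigma> \<in> shuffle_perms k m" for \<sigma>
  proof -
    have "\<sigma> permutes {..<k + m}"
      using that by (simp add: shuffle_perms_def)
    then show ?thesis
      using permutes_imp_permutation[OF _ shift_permutes]
      by (simp add: sign_compose permutation_cyc sign_cyc sign_shift)
  qed
  moreover have "map (\<lambda>i. (x # xs) ! (shift \<sigma> \<circ> cyc k) i) [0..<k] = map (\<lambda>i. xs ! \<sigma> i) [0..<k]" for \<sigma>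
    by (rule map_cong) (auto simp: cyc_apply)
  moreover have "map (\<lambda>i. (x # xs) ! (shift \<sigma> \<circ> cyc k) i) [k..<k + Suc m]
      = x # map (\<lambda>i. xs ! \<sigma> i) [k..<k + m]" for \<sigma>
    by (simp add: cyc_apply upt_conv_Cons map_Suc_upt[symmetric] o_def del: upt_Suc map_Suc_upt)
  moreover have "inj_on (\<lambda>\<sigma>. shift \<sigma> \<circ> cyc k) (shuffle_perms k m)"
  proof (rule inj_onI)
    fix \<sigma> \<tau>
    assume "shift \<sigma> \<circ> cyc k = shift \<tau> \<circ> cyc k"
    then have "shift \<sigma> = shift \<tau>"
      using permutes_surj[OF cyc_permutes] by (metis fun.map_comp o_id surj_iff)
    then show "\<sigma> = \<tau>"
      using inj_shift by (rule injD[rotated])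
  qed
  ultimately show ?thesis
    unfolding shuffle_perms_hd2 shuffle_sum_def scale_sum_right
    by (subst sum.reindex) (simp_all del: upt_Suc map_eq_conv cong: map_cong)
qed

lemma shuffle_sum_split:
  assumes "k + m > 0"
  shows "shuffle_sum k m f (x # xs) =
      (if k = 0 then 0 else shuffle_sum (k - 1) m (\<lambda>us. f (x # us)) xs)
    + (if m = 0 then 0 else (-1) ^ k *s shuffle_sum k (m - 1) (\<lambda>us vs. f us (x # vs)) xs)"
proof -
  define T where "T \<sigma> = of_int (sign \<sigma>) *s
    f (map (\<lambda>i. (x # xs) ! \<sigma> i) [0..<k]) (map (\<lambda>i. (x # xs) ! \<sigma> i) [k..<k + m])" for \<sigma>
  \<comment> \<open>The guard \<open>k > 0\<close> keeps the two sets disjoint, since for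
    \<open>k = 0\<close> the positions \<open>0\<close> and \<open>k\<close> coincide.\<close>
  let ?A = "{\<sigma>. \<sigma> \<in> shuffle_perms k m \<and> k > 0 \<and> \<sigma> 0 = 0}"
  let ?B = "{\<sigma>. \<sigma> \<in> shuffle_perms k m \<and> m > 0 \<and> \<sigma> k = 0}"
  have "\<sigma> k \<noteq> 0" if "k > 0" "\<sigma> \<in> shuffle_perms k m" "\<sigma> 0 = 0" for \<sigma>
  proof -
    have "inj \<sigma>"
      using that(2) permutes_inj by (auto simp: shuffle_perms_def)
    then show ?thesis
      using that(1,3) by (metis injD less_irrefl)
  qed
  then have disj: "?A \<inter> ?B = {}"
    by blast
  have "shuffle_perms k m = ?A \<union> ?B"
    using shuffle_perms_split[OF _ assms] by blast
  then have "shuffle_sum k m f (x # xs) = sum T (?A \<union> ?B)"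
    by (simp add: shuffle_sum_def T_def)
  also have "\<dots> = sum T ?A + sum T ?B"
    by (rule sum.union_disjoint[OF _ _ disj]) (auto intro: finite_subset[OF _ finite_shuffle_perms])
  also have "sum T ?A = (if k = 0 then 0 else shuffle_sum (k - 1) m (\<lambda>us. f (x # us)) xs)"
  proof (cases k)
    case (Suc k')
    show ?thesis
      using sum_shuffle_perms_hd1[where k = k' and m = m and f = f and x = x and xs = xs] by (simp add: T_def Suc del: upt_Suc)
  qed simp
  also have "sum T ?B =
      (if m = 0 then 0 else (-1) ^ k *s shuffle_sum k (m - 1) (\<lambda>us vs. f us (x # vs)) xs)"
  proof (cases m)
    case (Suc m')
    show ?thesis
      using sum_shuffle_perms_hd2[where k = k and m = m' and f = f and x = x and xs = xs] by (simp add: T_def Suc del: upt_Suc)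
  qed simp
  finally show ?thesis .
qed

text \<open>By \<open>shuffle_sum_split\<close> both sides obey the same recursion on the list; the
  support of \<open>f\<close> removes from \<open>shuf\<close> all splittings into blocks of other
  sizes.\<close>

lemma shuffle_sum_eq:
  assumes "length xs = k + m" "\<And>us vs. length us \<noteq> k \<or> length vs \<noteq> m \<Longrightarrow> f us vs = 0"
  shows "shuffle_sum k m f xs = shuf f xs"
  using assms
proof (induction xs arbitrary: k m f)
  case Nil
  then show ?case
    by (simp add: shuffle_sum_def shuffle_perms_0_0)
next
  case (Cons x xs)
  have "shuf (\<lambda>us. f (x # us)) xs
      = (if k = 0 then 0 else shuffle_sum (k - 1) m (\<lambda>us. f (x # us)) xs)"
  proof (cases "k = 0")
    case True
    then show ?thesis
      using Cons.prems(2) by (auto intro: shuf_vanish)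
  next
    case False
    have "shuffle_sum (k - 1) m (\<lambda>us. f (x # us)) xs = shuf (\<lambda>us. f (x # us)) xs"
    proof (rule Cons.IH)
      show "length xs = k - 1 + m"
        using Cons.prems(1) False by simp
      show "f (x # us) vs = 0" if "length us \<noteq> k - 1 \<or> length vs \<noteq> m" for us vs
        by (rule Cons.prems(2)) (use that False in auto)
    qed
    then show ?thesis
      using False by simp
  qed
  moreover have "shuf (\<lambda>us vs. (-1) ^ length us *s f us (x # vs)) xs
      = (if m = 0 then 0 else (-1) ^ k *s shuffle_sum k (m - 1) (\<lambda>us vs. f us (x # vs)) xs)"
  proof (cases "m = 0")
    case True
    then show ?thesis
      using Cons.prems(2) by (auto intro: shuf_vanish)
  next
    case False
    have "shuf (\<lambda>us vs. (-1) ^ length us *s f us (x # vs)) xs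
        = shuf (\<lambda>us vs. (-1) ^ k *s f us (x # vs)) xs"
    proof (rule shuf_cong)
      show "(-1) ^ length us *s f us (x # vs) = (-1) ^ k *s f us (x # vs)" for us vs
        using Cons.prems(2)[of us "x # vs"] by (cases "length us = k") auto
    qed
    also have "\<dots> = (-1) ^ k *s shuf (\<lambda>us vs. f us (x # vs)) xs"
      by (rule shuf_scale)
    also have "shuf (\<lambda>us vs. f us (x # vs)) xs = shuffle_sum k (m - 1) (\<lambda>us vs. f us (x # vs)) xs"
    proof (rule Cons.IH[symmetric])
      show "length xs = k + (m - 1)"
        using Cons.prems(1) False by simp
      show "f us (x # vs) = 0" if "length us \<noteq> k \<or> length vs \<noteq> m - 1" for us vs
        by (rule Cons.prems(2)) (use that False in auto)
    qed
    finally show ?thesis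
      using False by simp
  qed
  moreover have "k + m > 0"
    using Cons.prems(1) by auto
  ultimately show ?case
    by (simp add: shuffle_sum_split ins_eq shuf_add)
qed

lemma PL_diff_high_eq:
  assumes "f \<in> wedge_hom k (n - k)" "k < n"
  shows "PL_diff_high n k f = high f"
proof (intro ext)
  fix xs ys
  have f: "length us \<noteq> k \<or> length vs \<noteq> n - k \<Longrightarrow> f us vs = 0" for us vs
    using assms by (auto simp: wedge_hom_iff)
  show "PL_diff_high n k f xs ys = high f xs ys"
  proof (cases "length xs = n \<and> length ys = 1")
    case True
    \<comment> \<open>Here \<open>k < n\<close> makes \<open>n\<close> positive, so that
      \<open>n - 1\<close> is not truncated.\<close>
    have sgn: "(-1) ^ (n - Suc 0) *s v = - ((-1) ^ n *s v)" for v
      using assms(2) by (cases n) auto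
    have "shuf f xs = shuffle_sum k (n - k) f xs"
      using True assms(2) f by (intro shuffle_sum_eq[symmetric]) auto
    then show ?thesis
      using True assms(2)
      by (simp add: PL_diff_high_def high_def act_def shuffle_sum_def pl_sum_left pl_simps
          scale_sum_right sgn sum_negf flip: scale_scale)
  next
    case False
    have "high f xs ys = 0"
    proof (cases "length ys = 1")
      case True
      then have "shuf f xs = 0"
        using False assms(2) by (intro shuf_vanish f) auto
      then show ?thesis
        by (simp add: high_def act_def pl_simps)
    qed (simp add: high_def act_def)
    then show ?thesis
      by (simp only: PL_diff_high_def False if_False)
  qed
qed

section \<open>From single components to the complex\<close>

lemma ce_wedge_hom:
  assumes "f \<in> wedge_hom k m"
  shows "ce f \<in> wedge_hom (Suc k) m"
  using assms by (auto simp: wedge_hom_iff intro!: ce_vanish)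

lemma high_wedge_hom:
  assumes "f \<in> wedge_hom k m"
  shows "high f \<in> wedge_hom (k + m) 1"
proof -
  have "shuf f us = 0" if "length us \<noteq> k + m" for us
    using assms that by (intro shuf_vanish) (auto simp: wedge_hom_iff)
  with assms show ?thesis
    by (auto simp: wedge_hom_iff high_def act_def pl_simps)
qed

lemma sum_fun_apply: "(\<Sum>i\<in>I. F i) x = (\<Sum>i\<in>I. F i x)" for F :: "'i \<Rightarrow> 'b \<Rightarrow> 'd::ab_group_add"
  by (induction I rule: infinite_finite_induct) auto

text \<open>
  The components of a cochain live on disjoint sets of argument lengths, so the cochain is
  determined by their sum, on which the differential is \<open>ce + high\<close>.
\<close>

definition total :: "nat \<Rightarrow> (nat \<Rightarrow> 'a list \<Rightarrow> 'a list \<Rightarrow> 'a) \<Rightarrow> 'a list \<Rightarrow> 'a list \<Rightarrow> 'a" where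
  "total n f us vs = (\<Sum>k<n. f k us vs)"

lemma bialt_total:
  assumes "f \<in> PL_cochains n"
  shows "bialt (total n f)"
  unfolding total_def[abs_def] using assms
  by (intro bialt_sum) (auto simp: PL_cochains_def wedge_hom_iff)

text \<open>The top index \<open>k = n - 1\<close> follows the pattern of the lower ones:
  \<open>PL_diff_top\<close> is the sum of \<open>ce\<close> and \<open>high\<close>, and both land
  in component \<open>n\<close>.\<close>

lemma PL_diff_eq:
  assumes "f \<in> PL_cochains n"
  shows "PL_diff n f =
    (\<Sum>k<n. PL_component (Suc k) (ce (f k)) + PL_component n (high (f k)))"
proof (cases n)
  \<comment> \<open>Here \<open>f (n - 1)\<close> is \<open>f 0\<close>, but all sums in
    \<open>PL_diff_top 0\<close> are empty.\<close>
  case 0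
  then show ?thesis
    by (auto simp: PL_diff_def PL_component_def PL_diff_top_def fun_eq_iff)
next
  case (Suc m)
  have f: "f k \<in> wedge_hom k (n - k)" if "k < n" for k
    using assms that by (simp add: PL_cochains_def)
  have "PL_component n (PL_diff_top n (f m)) = PL_component (Suc m) (ce (f m)) + PL_component n (high (f m))"
    using f[of m] Suc by (auto simp: PL_diff_top_eq PL_component_def fun_eq_iff)
  moreover have "PL_diff_low n k (f k) = ce (f k)" "PL_diff_high n k (f k) = high (f k)" if "k < n" for k
    using PL_diff_low_eq[OF f[OF that]] PL_diff_high_eq[OF f[OF that] that] .
  then have "(\<Sum>k<m. PL_component (k + 1) (PL_diff_low n k (f k)) + PL_component n (PL_diff_high n k (f k)))
      = (\<Sum>k<m. PL_component (Suc k) (ce (f k)) + PL_component n (high (f k)))"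
    using Suc by (intro sum.cong) simp_all
  ultimately show ?thesis
    by (simp add: PL_diff_def Suc)
qed

lemma PL_diff_apply:
  assumes "f \<in> PL_cochains n"
  shows "PL_diff n f i us vs =
    (\<Sum>k<n. (if i = Suc k then ce (f k) us vs else 0) + (if i = n then high (f k) us vs else 0))"
  by (auto simp: PL_diff_eq[OF assms] sum_fun_apply PL_component_def intro!: sum.cong)

lemma total_PL_diff:
  assumes "f \<in> PL_cochains n"
  shows "total (Suc n) (PL_diff n f) us vs = ce (total n f) us vs + high (total n f) us vs"
proof -
  have "total (Suc n) (PL_diff n f) us vs
      = (\<Sum>k<n. \<Sum>i<Suc n. (if i = Suc k then ce (f k) us vs else 0) + (if i = n then high (f k) us vs else 0))"
    unfolding total_def PL_diff_apply[OF assms] by (rule sum.swap)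
  \<comment> \<open>For \<open>k < n\<close>, each of \<open>Suc k\<close> and \<open>n\<close> is
    met exactly once by the inner index.\<close>
  also have "\<dots> = (\<Sum>k<n. ce (f k) us vs + high (f k) us vs)"
    by (intro sum.cong refl) (simp add: sum.distrib del: sum.lessThan_Suc)
  finally show ?thesis
    by (simp add: total_def[abs_def] ce_sum high_sum sum.distrib)
qed

lemma PL_cochains_component:
  assumes "g \<in> wedge_hom i (n - i)" "i < n"
  shows "PL_component i g \<in> PL_cochains n"
  using assms by (auto simp: PL_cochains_def PL_component_def wedge_hom_iff zero_fun_def)

lemma PL_cochains_zero: "0 \<in> PL_cochains n"
  by (auto simp: PL_cochains_def wedge_hom_iff zero_fun_def)

lemma PL_cochains_add: "f \<in> PL_cochains n \<Longrightarrow> g \<in> PL_cochains n \<Longrightarrow> f + g \<in> PL_cochains n"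
  by (auto simp: PL_cochains_def wedge_hom_iff zero_fun_def plus_fun_def)

lemma PL_cochains_scale: "f \<in> PL_cochains n \<Longrightarrow> (\<lambda>i us vs. c *s f i us vs) \<in> PL_cochains n"
  using bialt_length_scale[of _ "\<lambda>n. c"]
  by (auto simp: PL_cochains_def wedge_hom_iff zero_fun_def fun_eq_iff)

lemma PL_cochains_sum: "(\<And>i. i \<in> I \<Longrightarrow> F i \<in> PL_cochains n) \<Longrightarrow> sum F I \<in> PL_cochains n"
  by (induction I rule: infinite_finite_induct) (auto intro: PL_cochains_zero PL_cochains_add)

lemma PL_diff_closed:
  assumes "f \<in> PL_cochains n"
  shows "PL_diff n f \<in> PL_cochains (Suc n)"
proof -
  have "PL_component (Suc k) (ce (f k)) \<in> PL_cochains (Suc n)"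
    "PL_component n (high (f k)) \<in> PL_cochains (Suc n)" if "k < n" for k
  proof -
    have f: "f k \<in> wedge_hom k (n - k)"
      using assms that by (simp add: PL_cochains_def)
    show "PL_component (Suc k) (ce (f k)) \<in> PL_cochains (Suc n)"
      using ce_wedge_hom[OF f] that by (intro PL_cochains_component) simp_all
    show "PL_component n (high (f k)) \<in> PL_cochains (Suc n)"
      using high_wedge_hom[OF f] that by (intro PL_cochains_component) simp_all
  qed
  then show ?thesis
    unfolding PL_diff_eq[OF assms] by (intro PL_cochains_sum PL_cochains_add) auto
qed

lemma PL_cochains_eq_0:
  assumes "f \<in> PL_cochains n" "total n f = (\<lambda>us vs. 0)"
  shows "f = 0"
proof -
  have "f i us vs = 0" for i us vs
  proof (cases "i < n \<and> length us = i")
    case True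
    have "f k us vs = 0" if "k \<noteq> i" "k < n" for k
      using assms(1) that True by (auto simp: PL_cochains_def wedge_hom_iff)
    then have "total n f us vs = f i us vs"
      unfolding total_def using True sum.remove[of "{..<n}" i "\<lambda>k. f k us vs"] by simp
    then show ?thesis
      using assms(2) by simp
  next
    case False
    then show ?thesis
      using assms(1) by (cases "i < n") (auto simp: PL_cochains_def wedge_hom_iff)
  qed
  then show ?thesis
    by (auto simp: fun_eq_iff)
qed

text \<open>On totals the square becomes that of \<open>ce + high\<close>, which vanishes by
  \<open>cochain_square\<close>; a cochain with zero total is zero.\<close>

lemma PL_diff_PL_diff:
  assumes "f \<in> PL_cochains n"
  shows "PL_diff (Suc n) (PL_diff n f) = 0"
proof (rule PL_cochains_eq_0)
  show "PL_diff (Suc n) (PL_diff n f) \<in> PL_cochains (Suc (Suc n))"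
    using assms by (intro PL_diff_closed)
  have eq: "total (Suc n) (PL_diff n f) = (\<lambda>us vs. ce (total n f) us vs + high (total n f) us vs)"
    using total_PL_diff[OF assms] by (simp add: fun_eq_iff)
  show "total (Suc (Suc n)) (PL_diff (Suc n) (PL_diff n f)) = (\<lambda>us vs. 0)"
    unfolding fun_eq_iff total_PL_diff[OF PL_diff_closed[OF assms]] eq
    using cochain_square[OF bialt_total[OF assms]] by simp
qed

lemma lie_scale: "lie x (\<lambda>us vs. c *s f us vs) us vs = c *s lie x f us vs"
  using lie_length_scale[of x "\<lambda>n. c"] by simp

lemma ce_scale: "ce (\<lambda>us vs. c *s f us vs) us vs = c *s ce f us vs"
  by (induction us arbitrary: f) (auto simp: lie_scale scale_right_diff_distrib)

lemma high_scale: "high (\<lambda>us vs. c *s f us vs) us vs = c *s high f us vs"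
  by (simp add: high_def act_def shuf_scale pl_simps algebra_simps)

lemma PL_diff_add:
  assumes "f \<in> PL_cochains n" "g \<in> PL_cochains n"
  shows "PL_diff n (f + g) = PL_diff n f + PL_diff n g"
proof (intro ext)
  fix i us vs
  have "ce (f k + g k) us vs = ce (f k) us vs + ce (g k) us vs"
    "high (f k + g k) us vs = high (f k) us vs + high (g k) us vs" for k
    by (simp_all add: plus_fun_def ce_add high_add)
  then show "PL_diff n (f + g) i us vs = (PL_diff n f + PL_diff n g) i us vs"
    by (simp add: PL_diff_apply assms PL_cochains_add flip: sum.distrib)
      (auto intro!: sum.cong)
qed

lemma PL_diff_scale:
  assumes "f \<in> PL_cochains n"
  shows "PL_diff n (\<lambda>i us vs. c *s f i us vs) = (\<lambda>i us vs. c *s PL_diff n f i us vs)"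
  by (intro ext)
    (auto simp: PL_diff_apply assms PL_cochains_scale ce_scale high_scale scale_sum_right
      scale_right_distrib intro!: sum.cong)

lemma PL_cochain_complex:
  "cochain_complex (\<lambda>c (f :: nat \<Rightarrow> 'a list \<Rightarrow> 'a list \<Rightarrow> 'a) i xs ys. c *s f i xs ys) PL_cochains PL_diff"
proof -
  interpret V: vector_space "\<lambda>c (f :: nat \<Rightarrow> 'a list \<Rightarrow> 'a list \<Rightarrow> 'a) i xs ys. c *s f i xs ys"
    by unfold_locales (auto simp: fun_eq_iff scale_right_distrib scale_left_distrib)
  show ?thesis
    by unfold_locales
      (auto simp: V.subspace_def PL_cochains_zero PL_cochains_add PL_cochains_scale PL_diff_closed
        PL_diff_add PL_diff_scale PL_diff_PL_diff)
qed

end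

theorem theorem3p1:
  fixes scale :: "'k::field_char_0 \<Rightarrow> 'a::ab_group_add \<Rightarrow> 'a"
    and pl :: "'a \<Rightarrow> 'a \<Rightarrow> 'a"
  assumes "pre_lie_algebra scale pl"
  shows "cochain_complex
           (\<lambda>(c::'k) (f::nat \<Rightarrow> 'a list \<Rightarrow> 'a list \<Rightarrow> 'a) i xs ys. scale c (f i xs ys))
           (pre_lie_algebra.PL_cochains scale)
           (pre_lie_algebra.PL_diff scale pl)"
  using pre_lie_algebra.PL_cochain_complex[OF assms] .

end
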